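(* Let $t$ be an indeterminate and put $\mathcal{F}_{1}(t) = {}_{2}F_{1}\left( \tfrac{1}{12}, \tfrac{5}{12} ; 1 ; 1728t \right)$, $\mathcal{F}_{2}(t) = {}_{2}F_{1}\left( -\tfrac{1}{12}, \tfrac{7}{12} ; 1 ; 1728t \right)$ as formal power series, and let \[ \mathcal{F} := \mathbb{C}\left[ \mathcal{F}_{1}(t) \mathcal{F}_{2}(t),\ \mathcal{F}_{1}(t)^{4},\ (1-1728t)^{1/2} \mathcal{F}_{1}(t)^{6}\right]\subset \mathbb{C}[\![t]\!], \] where $(1-1728t)^{1/2}$ is the binomial series. Then the $\mathbb{C}$-algebra homomorphism $QM_{*}(SL_2(\mathbb{Z}))=\mathbb{C}[E_2,E_4,E_6]\to\mathcal{F}$ sending $E_2\mapsto \mathcal{F}_1\mathcal{F}_2$, $E_4\mapsto\mathcal{F}_1^4$, $E_6\mapsto(1-1728t)^{1/2}\mathcal{F}_1^6$ (equivalently, expanding a quasimodular form as a power series in $t=1/j(\tau)$) is a ring isomorphism $QM_*(SL_2(\mathbb{Z}))\simeq\mathcal{F}$. Moreover $\mathcal{F}$ is closed under the derivation $D_{\mathcal{F}}:=(1-1728t)^{1/2}\mathcal{F}_{1}(t)^{2}\, t \tfrac{d}{d t}$, and this isomorphism carries $D=q\tfrac{d}{dq}$ to $D_{\mathcal{F}}$, so that $(QM_{*}(SL_2(\mathbb{Z})),D) \simeq (\mathcal{F}, D_{\mathcal{F}})$ as graded differential algebras over $\mathbb{C}$.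
   Context: $q=e^{2\pi i\tau}$; $E_2,E_4,E_6$ are the standard Eisenstein series $E_2=1-24\sum\sigma_1(n)q^n$, $E_4=1+240\sum\sigma_3(n)q^n$, $E_6=1-504\sum\sigma_5(n)q^n$, which are algebraically independent, and $QM_*(SL_2(\mathbb{Z}))=\mathbb{C}[E_2,E_4,E_6]$ is the graded ring of quasimodular forms (weights $2,4,6$). $\Delta=(E_4^3-E_6^2)/1728$ and $j=E_4^3/\Delta$ is the elliptic modular function. The generalized hypergeometric series is ${}_pF_q(a_1,\dots,a_p;b_1,\dots,b_q;z)=\sum_{n\ge0}\frac{(a_1)_n\cdots(a_p)_n}{(b_1)_n\cdots(b_q)_n}\frac{z^n}{n!}$ with $(a)_n=a(a+1)\cdots(a+n-1)$. *)

theory Defs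
  imports "HOL-Computational_Algebra.Computational_Algebra"
begin

definition sigma_div :: "nat \<Rightarrow> nat \<Rightarrow> complex" where
  "sigma_div k n = (\<Sum>d\<in>{d. d dvd n}. of_nat d ^ k)"

definition E2q :: "complex fps" where
  "E2q = Abs_fps (\<lambda>n. if n = 0 then 1 else - 24 * sigma_div 1 n)"
definition E4q :: "complex fps" where
  "E4q = Abs_fps (\<lambda>n. if n = 0 then 1 else 240 * sigma_div 3 n)"
definition E6q :: "complex fps" where
  "E6q = Abs_fps (\<lambda>n. if n = 0 then 1 else - 504 * sigma_div 5 n)"

definition Deltaq :: "complex fps" where
  "Deltaq = (E4q ^ 3 - E6q ^ 2) / fps_const 1728"

text \<open>t = 1/j = Delta / E4^3 as a power series in q (E4 has constant term 1).\<close>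
definition tq :: "complex fps" where
  "tq = Deltaq / E4q ^ 3"

definition hyp2F1 :: "complex \<Rightarrow> complex \<Rightarrow> complex \<Rightarrow> complex \<Rightarrow> complex fps" where
  "hyp2F1 a b c k = Abs_fps (\<lambda>n. pochhammer a n * pochhammer b n
        / (pochhammer c n * fact n) * k ^ n)"

definition F1 :: "complex fps" where
  "F1 = hyp2F1 (1/12) (5/12) 1 1728"
definition F2 :: "complex fps" where
  "F2 = hyp2F1 (-1/12) (7/12) 1 1728"

definition sqrtS :: "complex fps" where
  "sqrtS = fps_binomial (1/2) oo (fps_const (-1728) * fps_X)"

text \<open>Multivariate polynomials C[X,Y,Z] represented as nested univariate polynomials
  (outer variable Z, then Y, innermost X).  eval3 P a b c substitutes X:=a, Y:=b, Z:=c.\<close>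
definition eval3 :: "complex poly poly poly \<Rightarrow> complex fps \<Rightarrow> complex fps \<Rightarrow> complex fps \<Rightarrow> complex fps" where
  "eval3 P a b c =
     poly (map_poly (\<lambda>Q. poly (map_poly (\<lambda>R. poly (map_poly fps_const R) a) Q) b) P) c"

definition G2 :: "complex fps" where "G2 = F1 * F2"
definition G4 :: "complex fps" where "G4 = F1 ^ 4"
definition G6 :: "complex fps" where "G6 = sqrtS * F1 ^ 6"

definition D_F :: "complex fps \<Rightarrow> complex fps" where
  "D_F G = sqrtS * F1 ^ 2 * fps_X * fps_deriv G"
definition D_q :: "complex fps \<Rightarrow> complex fps" where
  "D_q G = fps_X * fps_deriv G"

end

theory Submission
  imports Defs
begin

text \<open>
  Ramanujan's differential equations for \<open>E2, E4, E6\<close> are equivalent to convolution identities for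
  divisor sums. These follow from the bijection \<open>(a,b,x,y) \<mapsto> (a-b,b,x,x+y)\<close> between the solutions of
  \<open>a x + b y = n\<close> with \<open>a > b\<close> and those with \<open>y > x\<close>, applied to functions of \<open>(a,b)\<close> which are invariant
  under \<open>(a,b) \<mapsto> (b,a)\<close> and \<open>(a,b) \<mapsto> (a,a-b)\<close>: the powers of \<open>a\<^sup>2 - a b + b\<^sup>2\<close> and \<open>(a b (a - b))\<^sup>2\<close>.

  With \<open>s = (1 - 1728 t)\<^bsup>1/2\<^esup>\<close> and \<open>\<theta> = t d/dt\<close> the hypergeometric equations become the linear system
  \<open>12 s \<theta> F1 = F2 - s F1\<close>, \<open>12 s \<theta> F2 = s F2 - F1\<close>. Substituting \<open>t = 1/j\<close> turns it into a system in \<open>q\<close>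
  which, by Ramanujan's equations, also has the solution \<open>E4\<^bsup>1/4\<^esup>\<close>, \<open>E2 / E4\<^bsup>1/4\<^esup>\<close>, and a solution is
  determined by its constant terms.

  The monomials in \<open>F1 F2, F1\<^sup>4, s F1\<^sup>6\<close> are distinct monomials in \<open>s\<close>, \<open>r = F2/F1\<close>, \<open>F1\<close>, so it suffices that
  these three are algebraically independent. Under \<open>12 s \<theta>\<close> we have \<open>s \<mapsto> 6 (s\<^sup>2 - 1)\<close>,
  \<open>r \<mapsto> 2 s r - 1 - r\<^sup>2\<close> and \<open>F1 \<mapsto> (r - s) F1\<close>. Expanding a minimal algebraic relation around the
  solution \<open>r\<close> produces an equation whose solution would contain \<open>log t\<close>; this forces \<open>r\<close> to be a rational
  function of \<open>s\<close>, which is excluded by its behaviour at \<open>s = 1, -1, \<infinity>\<close>.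
\<close>

text \<open>As \<open>X d/dX\<close>, the operator \<open>D_q\<close> also serves as \<open>\<theta>\<close> on series in \<open>t\<close>.\<close>

lemma D_q_nth: "D_q f $ n = of_nat n * f $ n"
  by (cases n) (auto simp: D_q_def)

lemma D_q_add: "D_q (f + g) = D_q f + D_q g"
  and D_q_diff: "D_q (f - g) = D_q f - D_q g"
  and D_q_mult: "D_q (f * g) = D_q f * g + f * D_q g"
  and D_q_1 [simp]: "D_q 1 = 0"
  and D_q_numeral [simp]: "D_q (numeral k) = 0"
  by (simp_all add: D_q_def algebra_simps)

section \<open>Convolutions of divisor sums and Ramanujan's equations\<close>

definition quads :: "nat \<Rightarrow> (nat \<times> nat \<times> nat \<times> nat) set" where
  "quads n = {(a,b,x,y). 0 < a \<and> 0 < b \<and> 0 < x \<and> 0 < y \<and> a * x + b * y = n}"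

lemma finite_quads: "finite (quads n)"
proof (rule finite_subset)
  show "quads n \<subseteq> {..n} \<times> {..n} \<times> {..n} \<times> {..n}"
  proof
    fix q assume "q \<in> quads n"
    then obtain a b x y where q: "q = (a,b,x,y)"
      and *: "0 < a" "0 < b" "0 < x" "0 < y" "a * x + b * y = n"
      by (auto simp: quads_def)
    have "a \<le> a * x" "x \<le> a * x" "b \<le> b * y" "y \<le> b * y" using * by auto
    then have "a \<le> n" "b \<le> n" "x \<le> n" "y \<le> n" using *(5) by linarith+
    then show "q \<in> {..n} \<times> {..n} \<times> {..n} \<times> {..n}" by (simp add: q)
  qed
qed auto

lemma sum_quads_swap:
  "(\<Sum>(a,b,x,y)\<in>{q\<in>quads n. R q}. f a b x y)
     = (\<Sum>(a,b,x,y)\<in>{q\<in>quads n. case q of (a,b,x,y) \<Rightarrow> R (b,a,y,x)}. f b a y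
         x)"
  by (rule sum.reindex_bij_witness[where i = "\<lambda>(a,b,x,y). (b,a,y,x)" and j =
      "\<lambda>(a,b,x,y). (b,a,y,x)"])
     (auto simp: quads_def)

text \<open>The bijection respects the equation because
  \<open>a * x + b * y = (a - b) * x + b * (x + y)\<close>. The summand does not involve
  \<open>x\<close> and \<open>y\<close>, so only its first argument changes.\<close>

lemma sum_quads_shift:
  fixes f :: "nat \<Rightarrow> nat \<Rightarrow> 'a :: comm_monoid_add"
  shows "(\<Sum>(a,b,x,y)\<in>{(a,b,x,y)\<in>quads n. b < a}. f a b)
     = (\<Sum>(a,b,x,y)\<in>{(a,b,x,y)\<in>quads n. x < y}. f (a + b) b)"
  by (rule sum.reindex_bij_witness[where i = "\<lambda>(a,b,x,y). (a+b,b,x,y-x)" and j =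
      "\<lambda>(a,b,x,y). (a-b,b,x,x+y)"])
     (auto simp: quads_def algebra_simps diff_mult_distrib diff_mult_distrib2 le_add_diff_inverse
         trans_le_add1)

lemma sum_quads_split:
  fixes f :: "nat \<times> nat \<times> nat \<times> nat \<Rightarrow> 'a :: comm_monoid_add"
    and u v :: "nat \<times> nat \<times> nat \<times> nat \<Rightarrow> nat"
  shows "sum f (quads n) = sum f {q\<in>quads n. u q < v q} + sum f {q\<in>quads n. v q < u q}
           + sum f {q\<in>quads n. u q = v q}"
proof -
  have "quads n = {q\<in>quads n. u q < v q} \<union> {q\<in>quads n. v q < u q} \<union>
      {q\<in>quads n. u q = v q}"
    by auto
  then have "sum f (quads n) = sum f ({q\<in>quads n. u q < v q} \<union> {q\<in>quads n. v q < u q}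
      \<union> {q\<in>quads n. u q = v q})"
    by simp
  also have "\<dots> = sum f ({q\<in>quads n. u q < v q} \<union> {q\<in>quads n. v q < u q}) + sum
      f {q\<in>quads n. u q = v q}"
    by (rule sum.union_disjoint) (auto simp: finite_quads)
  also have "sum f ({q\<in>quads n. u q < v q} \<union> {q\<in>quads n. v q < u q}) = sum f
      {q\<in>quads n. u q < v q} + sum f {q\<in>quads n. v q < u q}"
    by (rule sum.union_disjoint) (auto simp: finite_quads)
  finally show ?thesis .
qed

text \<open>For \<open>a = b = d\<close> the equation becomes \<open>x + y = n div d\<close>, which
  has \<open>n div d - 1\<close> positive solutions.\<close>

lemma sum_quads_diag_ab:
  fixes f :: "nat \<Rightarrow> complex"
  assumes "n > 0"
  shows "(\<Sum>(a,b,x,y)\<in>{(a,b,x,y)\<in>quads n. a = b}. f a)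
     = (\<Sum>d\<in>{d. d dvd n}. (of_nat (n div d) - 1) * f d)"
proof -
  have fin: "finite {d. d dvd n}" using assms by simp
  have "(\<Sum>(a,b,x,y)\<in>{(a,b,x,y)\<in>quads n. a = b}. f a)
     = (\<Sum>(d,x)\<in>Sigma {d. d dvd n} (\<lambda>d. {0<..<n div d}). f d)"
    by (rule sum.reindex_bij_witness[where i = "\<lambda>(d,x). (d,d,x,n div d - x)" and j =
        "\<lambda>(a,b,x,y). (a,x)"])
       (use assms in \<open>auto simp: quads_def simp flip: distrib_left intro: dvd_pos_nat\<close>)
  also have "\<dots> = (\<Sum>d\<in>{d. d dvd n}. \<Sum>x\<in>{0<..<n div d}. f d)"
    using fin by (subst sum.Sigma) auto
  also have "\<dots> = (\<Sum>d\<in>{d. d dvd n}. (of_nat (n div d) - 1) * f d)"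
  proof (rule sum.cong[OF refl])
    fix d assume "d \<in> {d. d dvd n}"
    then have "n div d \<ge> 1" using assms
      by (metis One_nat_def Suc_leI div_greater_zero_iff dvd_imp_le dvd_pos_nat mem_Collect_eq)
    then show "(\<Sum>x\<in>{0<..<n div d}. f d) = (of_nat (n div d) - 1) * f d"
      by (simp add: of_nat_diff)
  qed
  finally show ?thesis .
qed

text \<open>For \<open>x = y\<close> the equation becomes \<open>(a + b) * x = n\<close>, so
  \<open>d = a + b\<close> runs over the divisors of \<open>n\<close> and \<open>b\<close> over
  \<open>0 < b < d\<close>.\<close>

lemma sum_quads_diag_xy:
  fixes f :: "nat \<Rightarrow> nat \<Rightarrow> complex"
  assumes "n > 0"
  shows "(\<Sum>(a,b,x,y)\<in>{(a,b,x,y)\<in>quads n. x = y}. f (a + b) b)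
     = (\<Sum>d\<in>{d. d dvd n}. \<Sum>b\<in>{0<..<d}. f d b)"
proof -
  have fin: "finite {d. d dvd n}" using assms by simp
  have "(\<Sum>(a,b,x,y)\<in>{(a,b,x,y)\<in>quads n. x = y}. f (a+b) b)
     = (\<Sum>(d,b)\<in>Sigma {d. d dvd n} (\<lambda>d. {0<..<d}). f d b)"
    by (rule sum.reindex_bij_witness[where i = "\<lambda>(d,b). (d-b,b,n div d,n div d)" and j =
        "\<lambda>(a,b,x,y). (a+b,b)"])
       (use assms in \<open>auto simp: quads_def simp flip: distrib_right intro:
           dvd_pos_nat\<close>)
  also have "\<dots> = (\<Sum>d\<in>{d. d dvd n}. \<Sum>b\<in>{0<..<d}. f d b)"
    using fin by (subst sum.Sigma) auto
  finally show ?thesis .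
qed

text \<open>The first sum is split by comparing \<open>a\<close> with \<open>b\<close>, the second
  by comparing \<open>x\<close> with \<open>y\<close>. Within each sum the two off-diagonal parts
  agree by swapping, and \<open>sum_quads_shift\<close> matches them across the sums, so only the
  diagonals survive. The hypothesis \<open>refl\<close> is invariance under
  \<open>(a,b) \<mapsto> (a,a-b)\<close>.\<close>

lemma sum_quads_invariant:
  fixes F :: "nat \<Rightarrow> nat \<Rightarrow> complex"
  assumes "n > 0" and sym: "\<And>a b. F a b = F b a" and refl: "\<And>a b. F (a + b) a = F (a + b)
      b"
  shows "(\<Sum>(a,b,x,y)\<in>quads n. F a b - F (a + b) b)
     = (\<Sum>d\<in>{d. d dvd n}. (of_nat (n div d) - 1) * F d d - (\<Sum>b\<in>{0<..<d}. F d b))"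
proof -
  have comm: "F (b + a) a = F (a + b) b" for a b
    using refl[of a b] by (simp add: add.commute)
  let ?S = "\<lambda>R f. (\<Sum>(a,b,x,y)\<in>{(a,b,x,y)\<in>quads n. R a b x y}. f a b ::
      complex)"
  have 1: "?S (\<lambda>a b x y. a < b) F = ?S (\<lambda>a b x y. b < a) F"
    using sum_quads_swap[of "\<lambda>a b x y. F a b" n "\<lambda>(a,b,x,y). a < b"]
    by (simp add: case_prod_unfold sym)
  have 2: "?S (\<lambda>a b x y. y < x) (\<lambda>a b. F (a + b) b) = ?S (\<lambda>a b x y. x < y)
      (\<lambda>a b. F (a + b) b)"
    using sum_quads_swap[of "\<lambda>a b x y. F (a + b) b" n "\<lambda>(a,b,x,y). y < x"]
    by (simp add: case_prod_unfold comm)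
  have 3: "?S (\<lambda>a b x y. b < a) F = ?S (\<lambda>a b x y. x < y) (\<lambda>a b. F (a + b)
      b)"
    by (rule sum_quads_shift)
  have 4: "(\<Sum>(a,b,x,y)\<in>quads n. F a b) = ?S (\<lambda>a b x y. a < b) F + ?S (\<lambda>a b
      x y. b < a) F + ?S (\<lambda>a b x y. a = b) F"
    using sum_quads_split[of "\<lambda>(a,b,x,y). F a b" n "\<lambda>(a,b,x,y). a"
        "\<lambda>(a,b,x,y). b"]
    by (simp add: case_prod_unfold)
  have 5: "(\<Sum>(a,b,x,y)\<in>quads n. F (a + b) b) = ?S (\<lambda>a b x y. x < y) (\<lambda>a b.
      F (a + b) b)
      + ?S (\<lambda>a b x y. y < x) (\<lambda>a b. F (a + b) b) + ?S (\<lambda>a b x y. x = y)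
          (\<lambda>a b. F (a + b) b)"
    using sum_quads_split[of "\<lambda>(a,b,x,y). F (a + b) b" n "\<lambda>(a,b,x,y). x"
        "\<lambda>(a,b,x,y). y"]
    by (simp add: case_prod_unfold)
  have 6: "?S (\<lambda>a b x y. a = b) F = ?S (\<lambda>a b x y. a = b) (\<lambda>a b. F a a)"
    by (rule sum.cong) auto
  have "(\<Sum>(a,b,x,y)\<in>quads n. F a b - F (a + b) b)
      = (\<Sum>(a,b,x,y)\<in>quads n. F a b) - (\<Sum>(a,b,x,y)\<in>quads n. F (a + b) b)"
    by (simp add: case_prod_unfold sum_subtractf)
  also have "\<dots> = ?S (\<lambda>a b x y. a = b) F - ?S (\<lambda>a b x y. x = y) (\<lambda>a b.
      F (a + b) b)"
    unfolding 4 5 1 2 3 by simp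
  also have "\<dots> = (\<Sum>d\<in>{d. d dvd n}. (of_nat (n div d) - 1) * F d d) - (\<Sum>d\<in>{d.
      d dvd n}. (\<Sum>b\<in>{0<..<d}. F d b))"
    unfolding 6 using sum_quads_diag_ab[OF assms(1), of "\<lambda>a. F a a"] sum_quads_diag_xy[OF
        assms(1), of F]
    by simp
  finally show ?thesis by (simp add: sum_subtractf)
qed

section \<open>Products of generating series of divisor sums\<close>

definition Sq :: "nat \<Rightarrow> complex fps" where "Sq k = Abs_fps (sigma_div k)"

text \<open>Every number divides 0, so the sum runs over an infinite set and takes its default value
  0. Hence \<open>Sq k\<close> has no constant term.\<close>

lemma sigma_div_0 [simp]: "sigma_div k 0 = 0"
  by (simp add: sigma_div_def)

text \<open>Divisors \<open>a\<close> of \<open>m\<close> and \<open>b\<close> of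
  \<open>n - m\<close> with their codivisors \<open>x\<close> and \<open>y\<close> are exactly the
  solutions of \<open>a * x + b * y = n\<close>.\<close>

lemma Sq_mult_nth:
  "(Sq i * Sq j) $ n = (\<Sum>(a,b,x,y)\<in>quads n. of_nat a ^ i * of_nat b ^ j)"
proof -
  have pos: "0 < b" "b \<le> n - m" if "b dvd n - m" "m < n" for b m
    using that by (auto intro: dvd_imp_le dvd_pos_nat[of "n - m"])
  have "(Sq i * Sq j) $ n = (\<Sum>m=0..n. sigma_div i m * sigma_div j (n - m))"
    by (simp add: fps_mult_nth Sq_def)
  \<comment> \<open>The end terms contain a factor \<open>sigma_div _ 0 = 0\<close>; without them
    both sets of divisors are finite.\<close>
  also have "\<dots> = (\<Sum>m\<in>{0<..<n}. sigma_div i m * sigma_div j (n - m))"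
    by (rule sum.mono_neutral_right) (auto simp: not_less)
  also have "\<dots> = (\<Sum>m\<in>{0<..<n}. \<Sum>(a,b)\<in>{a. a dvd m} \<times> {b. b dvd n -
      m}. of_nat a ^ i * of_nat b ^ j)"
    by (simp add: sigma_div_def sum_product sum.cartesian_product)
  also have "\<dots> = (\<Sum>(m,a,b)\<in>Sigma {0<..<n} (\<lambda>m. {a. a dvd m} \<times> {b. b
      dvd n - m}). of_nat a ^ i * of_nat b ^ j)"
    by (subst sum.Sigma) (auto simp: case_prod_unfold)
  also have "\<dots> = (\<Sum>(a,b,x,y)\<in>quads n. of_nat a ^ i * of_nat b ^ j)"
    by (rule sum.reindex_bij_witness[where i = "\<lambda>(a,b,x,y). (a*x,a,b)" and j =
        "\<lambda>(m,a,b). (a,b,m div a, (n-m) div b)"])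
         (auto simp: quads_def div_greater_zero_iff pos intro: dvd_imp_le dvd_pos_nat)
  finally show ?thesis .
qed

text \<open>As \<open>n div d * d = n\<close>, the count from the diagonal \<open>a = b\<close>
  becomes a factor \<open>n\<close>, that is, \<open>D_q\<close> applied to \<open>Sq k\<close>.
  This is how derivatives enter Ramanujan's equations.\<close>

lemma Sq_nth_sum:
  assumes "n > 0"
  shows "(\<Sum>d\<in>{d. d dvd n}. of_nat (n div d) * of_nat d ^ Suc k) = of_nat n * Sq k $ n"
proof -
  have "of_nat (n div d) * of_nat d ^ Suc k = (of_nat n * of_nat d ^ k :: complex)" if "d dvd n" for
      d
  proof -
    have "of_nat (n div d) * of_nat d = (of_nat n :: complex)"
      using that by (metis dvd_div_mult_self of_nat_mult)
    then show ?thesis by (simp flip: mult.assoc)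
  qed
  then have "(\<Sum>d\<in>{d. d dvd n}. of_nat (n div d) * of_nat d ^ Suc k) = (\<Sum>d\<in>{d. d
      dvd n}. of_nat n * of_nat d ^ k :: complex)"
    by (intro sum.cong) auto
  then show ?thesis by (simp add: Sq_def sigma_div_def sum_distrib_left)
qed

lemma sum_powers_lessThan:
  fixes d :: nat
  defines "D \<equiv> of_nat d :: complex"
  shows "(\<Sum>b<d. of_nat b) = D^2/2 - D/2"
    and "(\<Sum>b<d. of_nat b ^ 2) = D^3/3 - D^2/2 + D/6"
    and "(\<Sum>b<d. of_nat b ^ 3) = D^4/4 - D^3/2 + D^2/4"
    and "(\<Sum>b<d. of_nat b ^ 4) = D^5/5 - D^4/2 + D^3/3 - D/30"
    and "(\<Sum>b<d. of_nat b ^ 5) = D^6/6 - D^5/2 + 5*D^4/12 - D^2/12"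
    and "(\<Sum>b<d. of_nat b ^ 6) = D^7/7 - D^6/2 + D^5/2 - D^3/6 + D/42"
proof -
  show "(\<Sum>b<d. of_nat b) = D^2/2 - D/2"
    unfolding D_def by (induction d) (simp, simp add: field_simps, algebra?)
  show "(\<Sum>b<d. of_nat b ^ 2) = D^3/3 - D^2/2 + D/6"
    unfolding D_def by (induction d) (simp, simp add: field_simps, algebra?)
  show "(\<Sum>b<d. of_nat b ^ 3) = D^4/4 - D^3/2 + D^2/4"
    unfolding D_def by (induction d) (simp, simp add: field_simps, algebra?)
  show "(\<Sum>b<d. of_nat b ^ 4) = D^5/5 - D^4/2 + D^3/3 - D/30"
    unfolding D_def by (induction d) (simp, simp add: field_simps, algebra?)
  show "(\<Sum>b<d. of_nat b ^ 5) = D^6/6 - D^5/2 + 5*D^4/12 - D^2/12"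
    unfolding D_def by (induction d) (simp, simp add: field_simps, algebra?)
  show "(\<Sum>b<d. of_nat b ^ 6) = D^7/7 - D^6/2 + D^5/2 - D^3/6 + D/42"
    unfolding D_def by (induction d) (simp, simp add: field_simps, algebra?)
qed


lemma sum_greaterThanLessThan_0:
  assumes "d > 0" shows "(\<Sum>b\<in>{0<..<d}. f b :: complex) = (\<Sum>b<d. f b) - f (0::nat)"
proof -
  have "{..<d} = insert 0 {0<..<d}" using assms by auto
  then show ?thesis by simp
qed

lemma Sq_nth: "Sq k $ n = (\<Sum>d\<in>{d. d dvd n}. of_nat d ^ k)"
  by (simp add: Sq_def sigma_div_def)

text \<open>Here and in the next two lemmas \<open>F\<close> is a power of
  \<open>a^2 - a*b + b^2\<close>, whose value at \<open>(a+b,b)\<close> is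
  \<open>a^2 + a*b + b^2\<close>. The first power has difference \<open>-2*a*b\<close>.\<close>

lemma Sq_convolution_1_1:
  assumes "n > 0"
  shows "(-2) * (Sq 1 * Sq 1) $ n = of_nat n * Sq 1 $ n - 5/6 * Sq 3 $ n - 1/6 * Sq 1 $ n"
proof -
  define F where "F = (\<lambda>a b. (of_nat a ^ 2 - of_nat a * of_nat b + of_nat b ^ 2) ::
      complex)"
  have diag: "F d d = of_nat d ^ 2" for d
    unfolding F_def by (algebra | simp)
  have dsum: "(\<Sum>b\<in>{0<..<d}. F d b) = 5/6 * of_nat d ^ 3 - of_nat d ^ 2 + 1/6 * of_nat d"
    if "d dvd n" for d
  proof -
    have "d > 0" using that assms by (rule dvd_pos_nat[rotated])
    then have "(\<Sum>b\<in>{0<..<d}. F d b) = (\<Sum>b<d. F d b) - F d 0"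
      by (rule sum_greaterThanLessThan_0)
    also have "(\<Sum>b<d. F d b) = (\<Sum>b<d. of_nat d ^ 2 - of_nat d * of_nat b + of_nat b ^ 2)"
      unfolding F_def by (rule sum.cong[OF refl]) (rule refl | algebra)
    also have "\<dots> - F d 0 = 5/6 * of_nat d ^ 3 - of_nat d ^ 2 + 1/6 * of_nat d"
      unfolding sum.distrib sum_subtractf sum_distrib_left[symmetric] sum_powers_lessThan
          sum_constant card_lessThan
      by (simp add: F_def field_simps) algebra?
    finally show ?thesis .
  qed
  have "(-2) * (Sq 1 * Sq 1) $ n = (\<Sum>(a,b,x,y)\<in>quads n. (-2) * (of_nat a ^ 1 * of_nat b ^
      1))"
    by (simp only: Sq_mult_nth sum_distrib_left case_prod_unfold sum.distrib)
  also have "\<dots> = (\<Sum>(a,b,x,y)\<in>quads n. F a b - F (a + b) b)"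
    unfolding F_def of_nat_add by (rule sum.cong[OF refl], clarify) algebra
  also have "\<dots> = (\<Sum>d\<in>{d. d dvd n}. (of_nat (n div d) - 1) * F d d -
      (\<Sum>b\<in>{0<..<d}. F d b))"
    by (rule sum_quads_invariant[OF assms]; unfold F_def of_nat_add; algebra)
  \<comment> \<open>The term \<open>- d^2\<close> from the diagonal \<open>a = b\<close> cancels
    against the one in \<open>dsum\<close>.\<close>
  also have "\<dots> = (\<Sum>d\<in>{d. d dvd n}. of_nat (n div d) * of_nat d ^ Suc 1 - 5/6 * of_nat
      d ^ 3 - 1/6 * of_nat d ^ 1)"
    by (rule sum.cong[OF refl]) (simp add: dsum diag field_simps power_numeral_reduce)
  also have "\<dots> = of_nat n * Sq 1 $ n - 5/6 * Sq 3 $ n - 1/6 * Sq 1 $ n"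
    unfolding sum_subtractf sum.distrib Sq_nth_sum[OF assms] sum_distrib_left[symmetric]
        Sq_nth[symmetric] ..
  finally show ?thesis .
qed

text \<open>The square has difference \<open>-4*a*b*(a^2 + b^2)\<close>.\<close>

lemma Sq_convolution_1_3:
  assumes "n > 0"
  shows "(-4) * (Sq 1 * Sq 3) $ n + (-4) * (Sq 3 * Sq 1) $ n = of_nat n * Sq 3 $ n - 7/10 * Sq 5 $ n
      - 1/3 * Sq 3 $ n + 1/30 * Sq 1 $ n"
proof -
  define F where "F = (\<lambda>a b. (of_nat a ^ 2 - of_nat a * of_nat b + of_nat b ^ 2) ^ 2 ::
      complex)"
  have diag: "F d d = of_nat d ^ 4" for d
    unfolding F_def by (algebra | simp)
  have dsum: "(\<Sum>b\<in>{0<..<d}. F d b) = 7/10 * of_nat d ^ 5 - of_nat d ^ 4 + 1/3 * of_nat d ^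
      3 - 1/30 * of_nat d"
    if "d dvd n" for d
  proof -
    have "d > 0" using that assms by (rule dvd_pos_nat[rotated])
    then have "(\<Sum>b\<in>{0<..<d}. F d b) = (\<Sum>b<d. F d b) - F d 0"
      by (rule sum_greaterThanLessThan_0)
    also have "(\<Sum>b<d. F d b) = (\<Sum>b<d. of_nat d ^ 4 - 2 * of_nat d ^ 3 * of_nat b + 3 *
        of_nat d ^ 2 * of_nat b ^ 2 - 2 * of_nat d * of_nat b ^ 3 + of_nat b ^ 4)"
      unfolding F_def by (rule sum.cong[OF refl]) (rule refl | algebra)
    also have "\<dots> - F d 0 = 7/10 * of_nat d ^ 5 - of_nat d ^ 4 + 1/3 * of_nat d ^ 3 - 1/30 *
        of_nat d"
      unfolding sum.distrib sum_subtractf sum_distrib_left[symmetric] sum_powers_lessThan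
          sum_constant card_lessThan
      by (simp add: F_def field_simps) algebra?
    finally show ?thesis .
  qed
  have "(-4) * (Sq 1 * Sq 3) $ n + (-4) * (Sq 3 * Sq 1) $ n = (\<Sum>(a,b,x,y)\<in>quads n. (-4) *
      (of_nat a ^ 1 * of_nat b ^ 3) + (-4) * (of_nat a ^ 3 * of_nat b ^ 1))"
    by (simp only: Sq_mult_nth sum_distrib_left case_prod_unfold sum.distrib)
  also have "\<dots> = (\<Sum>(a,b,x,y)\<in>quads n. F a b - F (a + b) b)"
    unfolding F_def of_nat_add by (rule sum.cong[OF refl], clarify) algebra
  also have "\<dots> = (\<Sum>d\<in>{d. d dvd n}. (of_nat (n div d) - 1) * F d d -
      (\<Sum>b\<in>{0<..<d}. F d b))"
    by (rule sum_quads_invariant[OF assms]; unfold F_def of_nat_add; algebra)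
  also have "\<dots> = (\<Sum>d\<in>{d. d dvd n}. of_nat (n div d) * of_nat d ^ Suc 3 - 7/10 *
      of_nat d ^ 5 - 1/3 * of_nat d ^ 3 + 1/30 * of_nat d ^ 1)"
    by (rule sum.cong[OF refl]) (simp add: dsum diag field_simps power_numeral_reduce)
  also have "\<dots> = of_nat n * Sq 3 $ n - 7/10 * Sq 5 $ n - 1/3 * Sq 3 $ n + 1/30 * Sq 1 $ n"
    unfolding sum_subtractf sum.distrib Sq_nth_sum[OF assms] sum_distrib_left[symmetric]
        Sq_nth[symmetric] ..
  finally show ?thesis .
qed

text \<open>The cube has difference \<open>-6*a*b*(a^4 + b^4) - 14*a^3*b^3\<close>. The unwanted
  \<open>Sq 7\<close> is removed with the help of \<open>Sq_convolution_3_3\<close>.\<close>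

lemma Sq_convolution_1_5:
  assumes "n > 0"
  shows "(-6) * (Sq 1 * Sq 5) $ n + (-6) * (Sq 5 * Sq 1) $ n + (-14) * (Sq 3 * Sq 3) $ n = of_nat n
      * Sq 5 $ n - 83/140 * Sq 7 $ n - 1/2 * Sq 5 $ n + 7/60 * Sq 3 $ n - 1/42 * Sq 1 $ n"
proof -
  define F where "F = (\<lambda>a b. (of_nat a ^ 2 - of_nat a * of_nat b + of_nat b ^ 2) ^ 3 ::
      complex)"
  have diag: "F d d = of_nat d ^ 6" for d
    unfolding F_def by (algebra | simp)
  have dsum: "(\<Sum>b\<in>{0<..<d}. F d b) = 83/140 * of_nat d ^ 7 - of_nat d ^ 6 + 1/2 * of_nat d
      ^ 5 - 7/60 * of_nat d ^ 3 + 1/42 * of_nat d"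
    if "d dvd n" for d
  proof -
    have "d > 0" using that assms by (rule dvd_pos_nat[rotated])
    then have "(\<Sum>b\<in>{0<..<d}. F d b) = (\<Sum>b<d. F d b) - F d 0"
      by (rule sum_greaterThanLessThan_0)
    also have "(\<Sum>b<d. F d b) = (\<Sum>b<d. of_nat d ^ 6 - 3 * of_nat d ^ 5 * of_nat b + 6 *
        of_nat d ^ 4 * of_nat b ^ 2 - 7 * of_nat d ^ 3 * of_nat b ^ 3 + 6 * of_nat d ^ 2 * of_nat b
        ^ 4 - 3 * of_nat d * of_nat b ^ 5 + of_nat b ^ 6)"
      unfolding F_def by (rule sum.cong[OF refl]) (rule refl | algebra)
    also have "\<dots> - F d 0 = 83/140 * of_nat d ^ 7 - of_nat d ^ 6 + 1/2 * of_nat d ^ 5 - 7/60 *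
        of_nat d ^ 3 + 1/42 * of_nat d"
      unfolding sum.distrib sum_subtractf sum_distrib_left[symmetric] sum_powers_lessThan
          sum_constant card_lessThan
      by (simp add: F_def field_simps) algebra?
    finally show ?thesis .
  qed
  have "(-6) * (Sq 1 * Sq 5) $ n + (-6) * (Sq 5 * Sq 1) $ n + (-14) * (Sq 3 * Sq 3) $ n =
      (\<Sum>(a,b,x,y)\<in>quads n. (-6) * (of_nat a ^ 1 * of_nat b ^ 5) + (-6) * (of_nat a ^ 5 *
      of_nat b ^ 1) + (-14) * (of_nat a ^ 3 * of_nat b ^ 3))"
    by (simp only: Sq_mult_nth sum_distrib_left case_prod_unfold sum.distrib)
  also have "\<dots> = (\<Sum>(a,b,x,y)\<in>quads n. F a b - F (a + b) b)"
    unfolding F_def of_nat_add by (rule sum.cong[OF refl], clarify) algebra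
  also have "\<dots> = (\<Sum>d\<in>{d. d dvd n}. (of_nat (n div d) - 1) * F d d -
      (\<Sum>b\<in>{0<..<d}. F d b))"
    by (rule sum_quads_invariant[OF assms]; unfold F_def of_nat_add; algebra)
  also have "\<dots> = (\<Sum>d\<in>{d. d dvd n}. of_nat (n div d) * of_nat d ^ Suc 5 - 83/140 *
      of_nat d ^ 7 - 1/2 * of_nat d ^ 5 + 7/60 * of_nat d ^ 3 - 1/42 * of_nat d ^ 1)"
    by (rule sum.cong[OF refl]) (simp add: dsum diag field_simps power_numeral_reduce)
  also have "\<dots> = of_nat n * Sq 5 $ n - 83/140 * Sq 7 $ n - 1/2 * Sq 5 $ n + 7/60 * Sq 3 $ n -
      1/42 * Sq 1 $ n"
    unfolding sum_subtractf sum.distrib Sq_nth_sum[OF assms] sum_distrib_left[symmetric]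
        Sq_nth[symmetric] ..
  finally show ?thesis .
qed

text \<open>This \<open>F\<close> has difference \<open>-4*a^3*b^3\<close> and vanishes for
  \<open>a = b\<close>, so no derivative appears. The result is the classical identity
  \<open>E4^2 = E8\<close>.\<close>

lemma Sq_convolution_3_3:
  assumes "n > 0"
  shows "(-4) * (Sq 3 * Sq 3) $ n = 1/30 * Sq 3 $ n - 1/30 * Sq 7 $ n"
proof -
  define F where "F = (\<lambda>a b. (of_nat a * of_nat b * (of_nat a - of_nat b)) ^ 2 :: complex)"
  have diag: "F d d = 0" for d
    unfolding F_def by (algebra | simp)
  have dsum: "(\<Sum>b\<in>{0<..<d}. F d b) = 1/30 * of_nat d ^ 7 - 1/30 * of_nat d ^ 3"
    if "d dvd n" for d
  proof -
    have "d > 0" using that assms by (rule dvd_pos_nat[rotated])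
    then have "(\<Sum>b\<in>{0<..<d}. F d b) = (\<Sum>b<d. F d b) - F d 0"
      by (rule sum_greaterThanLessThan_0)
    also have "(\<Sum>b<d. F d b) = (\<Sum>b<d. of_nat d ^ 4 * of_nat b ^ 2 - 2 * of_nat d ^ 3 *
        of_nat b ^ 3 + of_nat d ^ 2 * of_nat b ^ 4)"
      unfolding F_def by (rule sum.cong[OF refl]) (rule refl | algebra)
    also have "\<dots> - F d 0 = 1/30 * of_nat d ^ 7 - 1/30 * of_nat d ^ 3"
      unfolding sum.distrib sum_subtractf sum_distrib_left[symmetric] sum_powers_lessThan
          sum_constant card_lessThan
      by (simp add: F_def field_simps) algebra?
    finally show ?thesis .
  qed
  have "(-4) * (Sq 3 * Sq 3) $ n = (\<Sum>(a,b,x,y)\<in>quads n. (-4) * (of_nat a ^ 3 * of_nat b ^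
      3))"
    by (simp only: Sq_mult_nth sum_distrib_left case_prod_unfold sum.distrib)
  also have "\<dots> = (\<Sum>(a,b,x,y)\<in>quads n. F a b - F (a + b) b)"
    unfolding F_def of_nat_add by (rule sum.cong[OF refl], clarify) algebra
  also have "\<dots> = (\<Sum>d\<in>{d. d dvd n}. (of_nat (n div d) - 1) * F d d -
      (\<Sum>b\<in>{0<..<d}. F d b))"
    by (rule sum_quads_invariant[OF assms]; unfold F_def of_nat_add; algebra)
  also have "\<dots> = (\<Sum>d\<in>{d. d dvd n}. 1/30 * of_nat d ^ 3 - 1/30 * of_nat d ^ 7)"
    by (rule sum.cong[OF refl]) (simp add: dsum diag field_simps power_numeral_reduce)
  also have "\<dots> = 1/30 * Sq 3 $ n - 1/30 * Sq 7 $ n"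
    unfolding sum_subtractf sum.distrib Sq_nth_sum[OF assms] sum_distrib_left[symmetric]
        Sq_nth[symmetric] ..
  finally show ?thesis .
qed


section \<open>Ramanujan's differential equations\<close>

lemma Eisenstein_Sq: "E2q = 1 - 24 * Sq 1" "E4q = 1 + 240 * Sq 3" "E6q = 1 - 504 * Sq 5"
  by (rule fps_ext; simp add: E2q_def E4q_def E6q_def Sq_def numeral_fps_const)+

lemma D_q_Sq1: "6 * D_q (Sq 1) = 5 * Sq 3 + Sq 1 - 12 * (Sq 1 * Sq 1)"
proof (rule fps_ext)
  fix n show "(6 * D_q (Sq 1)) $ n = (5 * Sq 3 + Sq 1 - 12 * (Sq 1 * Sq 1)) $ n"
  proof (cases "n > 0")
    case True
    show ?thesis using Sq_convolution_1_1[OF True]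
      by (simp add: numeral_fps_const D_q_nth del: One_nat_def) algebra
  qed (simp add: numeral_fps_const D_q_nth Sq_def)
qed

lemma D_q_Sq3: "30 * D_q (Sq 3) = 21 * Sq 5 + 10 * Sq 3 - Sq 1 - 240 * (Sq 1 * Sq 3)"
proof (rule fps_ext)
  fix n show "(30 * D_q (Sq 3)) $ n = (21 * Sq 5 + 10 * Sq 3 - Sq 1 - 240 * (Sq 1 * Sq 3)) $ n"
  proof (cases "n > 0")
    case True
    show ?thesis using Sq_convolution_1_3[OF True]
      by (simp add: numeral_fps_const D_q_nth mult.commute[of "Sq 3"] del: One_nat_def) algebra
  qed (simp add: numeral_fps_const D_q_nth Sq_def)
qed

lemma D_q_Sq5: "42 * D_q (Sq 5) = 21 * Sq 5 + 20 * Sq 3 + Sq 1 - 504 * (Sq 1 * Sq 5) + 2400 * (Sq 3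
    * Sq 3)"
proof (rule fps_ext)
  fix n show "(42 * D_q (Sq 5)) $ n = (21 * Sq 5 + 20 * Sq 3 + Sq 1 - 504 * (Sq 1 * Sq 5) + 2400 *
      (Sq 3 * Sq 3)) $ n"
  proof (cases "n > 0")
    case True
    show ?thesis using Sq_convolution_1_5[OF True] Sq_convolution_3_3[OF True]
      by (simp add: numeral_fps_const D_q_nth mult.commute[of "Sq 5"] del: One_nat_def) algebra
  qed (simp add: numeral_fps_const D_q_nth Sq_def)
qed

lemma Ramanujan_E2: "12 * D_q E2q = E2q ^ 2 - E4q"
  using D_q_Sq1 unfolding Eisenstein_Sq by (simp add: D_q_diff D_q_mult del: One_nat_def) algebra

lemma Ramanujan_E4: "3 * D_q E4q = E2q * E4q - E6q"
  using D_q_Sq3 unfolding Eisenstein_Sq by (simp add: D_q_add D_q_mult del: One_nat_def) algebra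

lemma Ramanujan_E6: "2 * D_q E6q = E2q * E6q - E4q ^ 2"
  using D_q_Sq5 unfolding Eisenstein_Sq by (simp add: D_q_diff D_q_mult del: One_nat_def) algebra

section \<open>The hypergeometric system\<close>

lemma numeral_mult_nth: "(numeral k * f :: complex fps) $ n = numeral k * f $ n"
  by (simp add: numeral_fps_const)

lemma numeral_X_mult_nth_Suc: "(numeral k * fps_X * f :: complex fps) $ Suc n = numeral k * f $ n"
  by (simp add: mult.assoc numeral_mult_nth)

lemma sqrtS_0 [simp]: "sqrtS $ 0 = 1"
  by (simp add: sqrtS_def)

lemma sqrtS_square: "sqrtS ^ 2 = 1 - 1728 * fps_X"
proof -
  have "sqrtS ^ 2 = fps_binomial (1/2) ^ 2 oo (fps_const (-1728) * fps_X)"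
    unfolding sqrtS_def by (rule fps_compose_power) simp
  also have "fps_binomial (1/2 :: complex) ^ 2 = 1 + fps_X"
    by (simp add: fps_binomial_power fps_binomial_1)
  also have "\<dots> oo (fps_const (-1728) * fps_X) = 1 - 1728 * fps_X"
    by (simp add: fps_compose_add_distrib numeral_fps_const flip: fps_const_neg)
  finally show ?thesis .
qed

lemma sqrtS_D: "2 * sqrtS * D_q sqrtS = sqrtS ^ 2 - 1"
proof -
  have "2 * sqrtS * D_q sqrtS = D_q (sqrtS ^ 2)"
    by (simp add: power2_eq_square D_q_mult algebra_simps)
  also have "\<dots> = - 1728 * fps_X"
    by (simp add: sqrtS_square D_q_def)
  finally show ?thesis by (simp add: sqrtS_square)
qed

lemma hyp2F1_0 [simp]: "hyp2F1 a b c k $ 0 = 1"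
  by (simp add: hyp2F1_def)

text \<open>With \<open>\<theta> = D_q\<close> and \<open>z = 1728 * fps_X\<close> this is
  \<open>\<theta>^2 f = z (\<theta> + a) (\<theta> + b) f\<close>; the left side is a pure square
  since the lower parameter is 1. Coefficientwise it is the ratio of consecutive hypergeometric
  terms.\<close>

lemma hyp2F1_ODE:
  fixes a b :: complex
  defines "f \<equiv> hyp2F1 a b 1 1728"
  shows "D_q (D_q f) = 1728 * fps_X * (D_q (D_q f) + fps_const (a + b) * D_q f + fps_const (a * b) *
      f)"
proof (rule fps_ext)
  fix n
  show "D_q (D_q f) $ n = (1728 * fps_X * (D_q (D_q f) + fps_const (a + b) * D_q f + fps_const (a *
      b) * f)) $ n"
  proof (cases n)
    case 0
    then show ?thesis by (simp add: D_q_nth mult.assoc numeral_mult_nth)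
  next
    case (Suc m)
    have "(1 + of_nat m :: complex) \<noteq> 0" using of_nat_neq_0[of m, where 'a = complex] by simp
    then have "of_nat (Suc m) ^ 2 * f $ Suc m = 1728 * (of_nat m + a) * (of_nat m + b) * f $ m"
      by (simp add: f_def hyp2F1_def pochhammer_Suc pochhammer_fact[symmetric] divide_simps)
         (simp add: power2_eq_square algebra_simps)
    then show ?thesis
      by (simp add: Suc D_q_nth numeral_X_mult_nth_Suc) (simp add: power2_eq_square algebra_simps)
  qed
qed

text \<open>The equation is a recurrence in which the next coefficient carries the nonzero factor
  \<open>(m + 1)^2\<close>, so the constant term determines the series.\<close>

lemma hyp2F1_unique:
  fixes a b :: complex
  assumes f: "D_q (D_q f) = 1728 * fps_X * (D_q (D_q f) + fps_const (a + b) * D_q f + fps_const (a *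
      b) * f)"
    and "f $ 0 = 1"
  shows "f = hyp2F1 a b 1 1728"
proof (rule fps_ext)
  have rec: "of_nat (Suc m) ^ 2 * g $ Suc m = 1728 * (of_nat m + a) * (of_nat m + b) * g $ m"
    if "D_q (D_q g) = 1728 * fps_X * (D_q (D_q g) + fps_const (a + b) * D_q g + fps_const (a * b) *
        g)" for g m
    using arg_cong[OF that, of "\<lambda>h. h $ Suc m"]
    by (simp add: D_q_nth numeral_X_mult_nth_Suc) (simp add: power2_eq_square algebra_simps)
  fix n show "f $ n = hyp2F1 a b 1 1728 $ n"
  proof (induction n)
    case (Suc n)
    have "of_nat (Suc n) ^ 2 * f $ Suc n = of_nat (Suc n) ^ 2 * hyp2F1 a b 1 1728 $ Suc n"
      unfolding rec[OF f] rec[OF hyp2F1_ODE] Suc ..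
    then show ?case by (simp del: of_nat_Suc)
  qed (use assms in simp)
qed

text \<open>The first equation forces \<open>F2 = y\<close> with \<open>y\<close> as defined below.
  The hypergeometric equation of \<open>F1\<close> then yields the second equation for
  \<open>y\<close>, and eliminating \<open>F1\<close> shows that \<open>y\<close> solves the
  hypergeometric equation of \<open>F2\<close>.\<close>

lemma F1_F2_system:
  shows D_F1: "12 * sqrtS * D_q F1 = F2 - sqrtS * F1"
    and D_F2: "12 * sqrtS * D_q F2 = sqrtS * F2 - F1"
proof -
  define z where "z = (1728 * fps_X :: complex fps)"
  define y where "y = sqrtS * (F1 + 12 * D_q F1)"
  have z: "z = 1 - sqrtS ^ 2" by (simp add: z_def sqrtS_square)
  \<comment> \<open>These clear denominators: both parameter pairs have sum \<open>1/2\<close>, and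
    their products are \<open>5/144\<close> and \<open>-7/144\<close>.\<close>
  have c: "144 * fps_const (5/144) = (5 :: complex fps)" "2 * fps_const (1/2) = (1 :: complex fps)"
          "144 * fps_const (7/144) = (7 :: complex fps)"
    by (simp_all add: numeral_fps_const fps_const_mult)
  have "D_q (D_q F1) = z * (D_q (D_q F1) + fps_const (1/2) * D_q F1 + fps_const (5/144) * F1)"
    using hyp2F1_ODE[of "1/12" "5/12"] by (simp add: F1_def z_def)
  then have "144 * D_q (D_q F1) = z * (144 * D_q (D_q F1) + 72 * D_q F1 + 5 * F1)"
    using c by algebra
  then have ODE: "144 * sqrtS ^ 2 * D_q (D_q F1) = z * (72 * D_q F1 + 5 * F1)"
    unfolding z by algebra
  have D_y: "D_q y = D_q sqrtS * (F1 + 12 * D_q F1) + sqrtS * (D_q F1 + 12 * D_q (D_q F1))"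
    by (simp add: y_def D_q_mult D_q_add)
  have 1: "12 * sqrtS * D_q y = sqrtS * y - F1"
    using ODE sqrtS_D unfolding D_y unfolding y_def z by algebra
  have "D_q (12 * sqrtS * D_q y) = D_q (sqrtS * y - F1)" using 1 by simp
  then have "12 * (D_q sqrtS * D_q y + sqrtS * D_q (D_q y)) = D_q sqrtS * y + sqrtS * D_q y - D_q
      F1"
    by (simp add: D_q_mult D_q_diff algebra_simps)
  then have "144 * sqrtS ^ 2 * D_q (D_q y) = z * (72 * D_q y - 7 * y)"
    using 1 sqrtS_D unfolding z y_def by algebra
  then have "144 * D_q (D_q y) = 144 * (z * (D_q (D_q y) + fps_const (1/2) * D_q y - fps_const
      (7/144) * y))"
    using c z by algebra
  then have "D_q (D_q y) = z * (D_q (D_q y) + fps_const (1/2) * D_q y - fps_const (7/144) * y)"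
    by simp
  then have "y = hyp2F1 (-1/12) (7/12) 1 1728"
    by (intro hyp2F1_unique) (simp_all add: z_def y_def F1_def D_q_nth numeral_mult_nth flip:
        fps_const_neg)
  then have "y = F2" by (simp add: F2_def)
  with 1 show "12 * sqrtS * D_q F2 = sqrtS * F2 - F1" by simp
  show "12 * sqrtS * D_q F1 = F2 - sqrtS * F1"
    unfolding \<open>y = F2\<close>[symmetric] y_def by (simp add: algebra_simps)
qed

section \<open>Expansion in 1/j\<close>

text \<open>Once the lower coefficients vanish, those of order \<open>n\<close> satisfy
  \<open>12 n x_n = y_n - x_n = 12 n y_n\<close>. For \<open>n > 0\<close> this gives
  \<open>x_n = y_n\<close> and then zero.\<close>

lemma linear_system_unique:
  fixes g w x y :: "complex fps"
  assumes "g $ 0 = 1" "w $ 0 = 1"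
    and x: "12 * D_q x = g * (y - w * x)" and y: "12 * D_q y = g * (w * y - x)"
    and "x $ 0 = 0" "y $ 0 = 0"
  shows "x = 0 \<and> y = 0"
proof -
  have "x $ n = 0 \<and> y $ n = 0" for n
  proof (induction n rule: less_induct)
    case (less n)
    have low: "(f * h) $ n = f $ 0 * h $ n" if "\<And>m. m < n \<Longrightarrow> h $ m = 0" for f h
        :: "complex fps"
    proof -
      have "(f * h) $ n = (\<Sum>i=0..n. f $ i * h $ (n - i))" by (rule fps_mult_nth)
      also have "\<dots> = (\<Sum>i\<in>{0}. f $ i * h $ (n - i))"
        by (rule sum.mono_neutral_right) (auto intro!: that)
      finally show ?thesis by simp
    qed
    have lw: "(w * x) $ m = 0" "(w * y) $ m = 0" if "m < n" for m
      using that less by (auto simp: fps_mult_nth intro!: sum.neutral)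
    have 1: "12 * (of_nat n * x $ n) = y $ n - x $ n"
      using arg_cong[OF x, of "\<lambda>h. h $ n"] assms(1,2) less lw
      by (simp add: low D_q_nth numeral_mult_nth)
    have 2: "12 * (of_nat n * y $ n) = y $ n - x $ n"
      using arg_cong[OF y, of "\<lambda>h. h $ n"] assms(1,2) less lw
      by (simp add: low D_q_nth numeral_mult_nth)
    show ?case
    proof (cases "n = 0")
      case False
      from 1 2 have "of_nat n * x $ n = of_nat n * y $ n"
        by (metis mult_cancel_left zero_neq_numeral)
      with False have "x $ n = y $ n" by simp
      with 1 2 False show ?thesis by simp
    qed (use assms in simp)
  qed
  then show ?thesis by (simp add: fps_eq_iff)
qed

lemma E_nth_0 [simp]: "E2q $ 0 = 1" "E4q $ 0 = 1" "E6q $ 0 = 1"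
  by (simp_all add: E2q_def E4q_def E6q_def)

lemma E_nz [simp]: "E4q \<noteq> 0" "E6q \<noteq> 0"
  by (metis E_nth_0(2) fps_zero_nth zero_neq_one, metis E_nth_0(3) fps_zero_nth zero_neq_one)

lemma tq_E4: "1728 * tq * E4q ^ 3 = E4q ^ 3 - E6q ^ 2"
proof -
  have "(E4q ^ 3) $ 0 = 1" by (simp add: fps_nth_power_0)
  then have "tq * E4q ^ 3 = Deltaq"
    unfolding tq_def by (simp add: fps_divide_unit mult.assoc inverse_mult_eq_1)
  moreover have "1728 * Deltaq = E4q ^ 3 - E6q ^ 2"
    unfolding Deltaq_def numeral_fps_const by (simp add: fps_divide_unit)
  ultimately show ?thesis by (simp add: mult.assoc)
qed

lemma tq_0 [simp]: "tq $ 0 = 0"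
  using arg_cong[OF tq_E4, of "\<lambda>h. h $ 0"]
      by (simp add: fps_nth_power_0 mult.assoc numeral_mult_nth)

text \<open>Differentiate \<open>tq_E4\<close> and insert Ramanujan's equations; the terms with
  \<open>E2q\<close> cancel, since \<open>1/j\<close> has weight 0.\<close>

lemma D_tq: "E4q * D_q tq = tq * E6q"
proof -
  have "D_q (1728 * tq * E4q ^ 3) = D_q (E4q ^ 3 - E6q ^ 2)" using tq_E4 by simp
  then have "1728 * (D_q tq * E4q ^ 3 + tq * (3 * E4q ^ 2 * D_q E4q)) = 3 * E4q ^ 2 * D_q E4q - 2 *
      E6q * D_q E6q"
    by (simp add: D_q_mult D_q_diff eval_nat_numeral algebra_simps)
  then have "1728 * E4q ^ 2 * (E4q * D_q tq - tq * E6q) = 0"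
    using tq_E4 Ramanujan_E4 Ramanujan_E6 by algebra
  then show ?thesis by simp
qed

lemma D_q_compose: "E4q * D_q (f oo tq) = E6q * (D_q f oo tq)"
proof -
  have "D_q (f oo tq) = (fps_deriv f oo tq) * D_q tq"
    by (simp add: D_q_def fps_compose_deriv algebra_simps)
  moreover have "D_q f oo tq = tq * (fps_deriv f oo tq)"
    by (simp add: D_q_def fps_compose_mult_distrib)
  ultimately show ?thesis using D_tq by algebra
qed

lemma numeral_compose [simp]: "numeral k oo (f :: complex fps) = numeral k"
  by (simp add: numeral_fps_const)

lemma F_compose_tq:
  shows F1_tq: "(F1 oo tq) ^ 4 = E4q"
    and F2_tq: "(F1 oo tq) * (F2 oo tq) = E2q"
    and sqrtS_tq: "(sqrtS oo tq) * (F1 oo tq) ^ 6 = E6q"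
proof -
  \<comment> \<open>\<open>a\<close> is the fourth root of \<open>E4q\<close> with constant term
    1.\<close>
  define a where "a = fps_radical (\<lambda>_ _. 1) (Suc 3) E4q"
  define w where "w = sqrtS oo tq"
  define u where "u = F1 oo tq"
  define v where "v = F2 oo tq"
  define b where "b = E2q * inverse a"
  have a4: "a ^ 4 = E4q"
    using power_radical[of E4q "\<lambda>_ _. 1" 3] by (simp add: a_def)
  have a0 [simp]: "a $ 0 = 1" by (simp add: a_def)
  then have a_nz: "a \<noteq> 0" by (metis fps_zero_nth zero_neq_one)
  have ab: "a * b = E2q" by (simp add: b_def inverse_mult_eq_1' algebra_simps)
  have b0: "b $ 0 = 1" by (simp add: b_def)
  have w0: "w $ 0 = 1" by (simp add: w_def)
  have u0: "u $ 0 = 1" "v $ 0 = 1" by (simp_all add: u_def v_def F1_def F2_def)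
  have "w ^ 2 = 1 - 1728 * tq"
    unfolding w_def by (simp add: fps_compose_power sqrtS_square fps_compose_sub_distrib
        fps_compose_mult_distrib)
  \<comment> \<open>Since \<open>w^2 = E6^2 / E4^3\<close>, the series \<open>w * a^6\<close> is
    \<open>E6q\<close> up to sign, and the constant terms decide the sign.\<close>
  then have "(w * a ^ 6) ^ 2 = E6q ^ 2"
    using tq_E4 a4 by algebra
  then have "w * a ^ 6 = E6q \<or> w * a ^ 6 = - E6q" by (simp add: power2_eq_iff)
  moreover have "(w * a ^ 6) $ 0 \<noteq> (- E6q) $ 0" by (simp add: fps_nth_power_0 w0)
  ultimately have wa: "w * a ^ 6 = E6q" by metis
  have "12 * w * (D_q F1 oo tq) = v - w * u"
    using arg_cong[OF D_F1, of "\<lambda>f. f oo tq"]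
    by (simp add: w_def u_def v_def fps_compose_mult_distrib fps_compose_sub_distrib)
  \<comment> \<open>\<open>D_q\<close> acts on series in \<open>tq\<close> as \<open>E6/E4\<close>
    times \<open>\<theta>\<close>, and \<open>E6 / (E4 * w) = a^2\<close>; the factor
    \<open>a^4 * w\<close> avoids the division.\<close>
  then have "a ^ 4 * w * (12 * D_q u) = a ^ 4 * w * (a ^ 2 * (v - w * u))"
    using D_q_compose[of F1] wa a4 unfolding u_def[symmetric] by algebra
  moreover have nz: "a ^ 4 * w \<noteq> 0" using a_nz w0 by auto
  ultimately have Du: "12 * D_q u = a ^ 2 * (v - w * u)" by (metis mult_cancel_left)
  have "12 * w * (D_q F2 oo tq) = w * v - u"
    using arg_cong[OF D_F2, of "\<lambda>f. f oo tq"]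
    by (simp add: w_def u_def v_def fps_compose_mult_distrib fps_compose_sub_distrib)
  then have "a ^ 4 * w * (12 * D_q v) = a ^ 4 * w * (a ^ 2 * (w * v - u))"
    using D_q_compose[of F2] wa a4 unfolding v_def[symmetric] by algebra
  then have Dv: "12 * D_q v = a ^ 2 * (w * v - u)" using nz by (metis mult_cancel_left)
  \<comment> \<open>Ramanujan's equations for \<open>E4 = a^4\<close> and \<open>E2 = a * b\<close>
    give the same linear system for \<open>a\<close> and \<open>b\<close>.\<close>
  have "D_q (a ^ 4) = D_q E4q" using a4 by simp
  then have DE4: "4 * a ^ 3 * D_q a = D_q E4q"
      by (simp add: eval_nat_numeral D_q_mult algebra_simps)
  have "a ^ 3 * (12 * D_q a) = 3 * (4 * a ^ 3 * D_q a)" by algebra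
  also have "\<dots> = (a * b) * a ^ 4 - w * a ^ 6"
    unfolding DE4 Ramanujan_E4 a4 ab wa ..
  also have "\<dots> = a ^ 3 * (a ^ 2 * (b - w * a))" by algebra
  finally have "a ^ 3 * (12 * D_q a) = a ^ 3 * (a ^ 2 * (b - w * a))" .
  then have Da: "12 * D_q a = a ^ 2 * (b - w * a)"
    using a_nz by (metis mult_cancel_left power_not_zero)
  have "a * (12 * D_q b) = 12 * D_q (a * b) - (12 * D_q a) * b"
    unfolding D_q_mult by algebra
  also have "\<dots> = (a * b) ^ 2 - a ^ 4 - a ^ 2 * (b - w * a) * b"
    unfolding Da unfolding ab a4 Ramanujan_E2 ..
  also have "\<dots> = a * (a ^ 2 * (w * b - a))" by algebra
  finally have "a * (12 * D_q b) = a * (a ^ 2 * (w * b - a))" .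
  then have Db: "12 * D_q b = a ^ 2 * (w * b - a)"
    using a_nz by (metis mult_cancel_left)
  have "u - a = 0 \<and> v - b = 0"
  proof (rule linear_system_unique)
    show "12 * D_q (u - a) = a ^ 2 * ((v - b) - w * (u - a))"
      using Du Da unfolding D_q_diff by algebra
    show "12 * D_q (v - b) = a ^ 2 * (w * (v - b) - (u - a))"
      using Dv Db unfolding D_q_diff by algebra
  qed (simp_all add: u0 b0 w0 fps_nth_power_0)
  then have "u = a" "v = b" by simp_all
  then show "(F1 oo tq) ^ 4 = E4q" "(F1 oo tq) * (F2 oo tq) = E2q"
    "(sqrtS oo tq) * (F1 oo tq) ^ 6 = E6q"
    using a4 ab wa by (simp_all add: u_def v_def w_def)
qed

text \<open>Under \<open>t = 1/j\<close> the factor \<open>sqrtS * F1^2\<close> becomes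
  \<open>E6/E4\<close>, exactly the factor in \<open>D_q_compose\<close>.\<close>

lemma D_F_compose: "D_F f oo tq = D_q (f oo tq)"
proof -
  have "D_F f = sqrtS * F1 ^ 2 * D_q f" by (simp add: D_F_def D_q_def mult.assoc)
  then have "D_F f oo tq = (sqrtS oo tq) * (F1 oo tq) ^ 2 * (D_q f oo tq)"
    by (simp add: fps_compose_mult_distrib fps_compose_power)
  then have "E4q * (D_F f oo tq) = E4q * D_q (f oo tq)"
    using D_q_compose[of f] F1_tq sqrtS_tq by algebra
  then show ?thesis by simp
qed

section \<open>Extending homomorphisms and derivations to polynomials\<close>

definition is_ring_hom :: "('a::comm_ring_1 \<Rightarrow> 'b::comm_ring_1) \<Rightarrow> bool" where
  "is_ring_hom h \<longleftrightarrow> h 1 = 1 \<and> (\<forall>a b. h (a + b) = h a + h b) \<and>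
      (\<forall>a b. h (a * b) = h a * h b)"

lemma is_ring_homD:
  assumes "is_ring_hom h"
  shows "h 1 = 1" "h (a + b) = h a + h b" "h (a * b) = h a * h b" "h 0 = 0" "h (- a) = - h a" "h (a
      - b) = h a - h b"
    "h (of_nat n) = of_nat n" "h (numeral k) = numeral k"
proof -
  show *: "h 1 = 1" "h (a * b) = h a * h b" and add: "h (a + b) = h a + h b" for a b
    using assms by (auto simp: is_ring_hom_def)
  show 0: "h 0 = 0" using add[of 0 0] by simp
  show m: "h (- a) = - h a" for a using add[of a "-a"] 0
      by (simp add: eq_neg_iff_add_eq_0 add.commute)
  show "h (a - b) = h a - h b" using add[of a "-b"] m by simp
  show nat: "h (of_nat n) = of_nat n" for n by (induction n) (simp_all add: 0 * add)
  show "h (numeral k) = numeral k" using nat[of "numeral k"] by simp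
qed

text \<open>Applied repeatedly to nested polynomials this evaluates several variables; three
  applications give \<open>eval3\<close>.\<close>

definition hom_eval :: "('a::comm_ring_1 \<Rightarrow> 'b::comm_ring_1) \<Rightarrow> 'b
    \<Rightarrow> 'a poly \<Rightarrow> 'b" where
  "hom_eval h x p = poly (map_poly h p) x"

lemma hom_eval_pCons:
  assumes "is_ring_hom h"
  shows "hom_eval h x (pCons a p) = h a + x * hom_eval h x p"
  by (simp add: hom_eval_def map_poly_pCons is_ring_homD[OF assms])

lemma hom_eval_0 [simp]: "hom_eval h x 0 = 0"
  by (simp add: hom_eval_def)

lemma is_ring_hom_hom_eval:
  assumes h: "is_ring_hom h"
  shows "is_ring_hom (hom_eval h x)"
proof -
  note [simp] = hom_eval_pCons[OF h] is_ring_homD[OF h]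
  have 1: "hom_eval h x 1 = 1" by (simp add: one_pCons)
  have add: "hom_eval h x (p + q) = hom_eval h x p + hom_eval h x q" for p q
  proof (induction p arbitrary: q)
    case (pCons a p)
    then show ?case by (cases q) (simp add: algebra_simps)
  qed simp
  have smult: "hom_eval h x (smult a p) = h a * hom_eval h x p" for a p
    by (induction p) (simp_all add: algebra_simps)
  have "hom_eval h x (p * q) = hom_eval h x p * hom_eval h x q" for p q
    by (induction p) (simp_all add: add smult algebra_simps)
  with 1 add show ?thesis by (simp add: is_ring_hom_def)
qed

lemma hom_eval_smult:
  assumes h: "is_ring_hom h"
  shows "hom_eval h x (smult a p) = h a * hom_eval h x p"
proof -
  have "hom_eval h x ([:a:] * p) = hom_eval h x [:a:] * hom_eval h x p"
    by (rule is_ring_homD(3)[OF is_ring_hom_hom_eval[OF h]])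
  then show ?thesis by (simp add: hom_eval_pCons[OF h])
qed

lemma is_ring_hom_fps_const: "is_ring_hom fps_const"
  by (simp add: is_ring_hom_def)

text \<open>For a derivation \<open>d\<close> of the coefficients, this is its extension sending the
  variable to \<open>e\<close>.\<close>

definition poly_derivation :: "('a::idom \<Rightarrow> 'a) \<Rightarrow> 'a poly \<Rightarrow> 'a
    poly \<Rightarrow> 'a poly" where
  "poly_derivation d e p = map_poly d p + pderiv p * e"

lemma poly_derivation_0: "poly_derivation d e 0 = 0"
  by (simp add: poly_derivation_def)

text \<open>Additivity makes \<open>map_poly d\<close> commute with \<open>pderiv\<close>, so the
  commutator comes only from the product rule for \<open>pderiv p * e\<close>. It allows identities
  between polynomials to be differentiated in the variable.\<close>

lemma pderiv_poly_derivation: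
  assumes "d 0 = 0" "\<And>a b. d (a + b) = d a + d b"
  shows "pderiv (poly_derivation d e p) = poly_derivation d e (pderiv p) + pderiv p * pderiv e"
proof -
  have nat: "d (of_nat n * a) = of_nat n * d a" for n a
    by (induction n) (simp_all add: assms algebra_simps)
  have "pderiv (map_poly d p) = map_poly d (pderiv p)"
    by (rule poly_eqI) (simp add: coeff_pderiv coeff_map_poly assms(1) nat del: of_nat_Suc)
  then show ?thesis by (simp add: poly_derivation_def pderiv_add pderiv_mult algebra_simps)
qed

text \<open>Both sides obey the same product rule and agree on coefficients (by \<open>hd\<close>)
  and on the variable (by \<open>e\<close>).\<close>

lemma hom_eval_poly_derivation:
  fixes h :: "'a::idom \<Rightarrow> 'b::comm_ring_1"
  assumes h: "is_ring_hom h" and "d 0 = 0"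
    and D: "\<And>f g. D (f + g) = D f + D g" "\<And>f g. D (f * g) = D f * g + f * D g" and "D 0 =
        0"
    and hd: "\<And>a. h (d a) = D (h a)" and e: "hom_eval h x e = D x"
  shows "hom_eval h x (poly_derivation d e p) = D (hom_eval h x p)"
proof -
  note H = is_ring_homD[OF is_ring_hom_hom_eval[OF h]]
  show ?thesis
  proof (induction p)
    case (pCons a p)
    then show ?case
      by (simp add: poly_derivation_def map_poly_pCons assms H hom_eval_pCons[OF h] pderiv_pCons
          is_ring_homD[OF h] algebra_simps)
  qed (simp add: poly_derivation_def \<open>D 0 = 0\<close>)
qed

section \<open>Rational solutions of the Riccati equation\<close>

text \<open>\<open>eq\<close> says that \<open>A/B\<close> solves
  \<open>6 (s^2 - 1) r' = 2 s r - 1 - r^2\<close>, and \<open>lowest\<close> that the fraction is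
  reduced. Reducedness gives \<open>A = 6 (s^2 - 1) B' + B * C\<close> with \<open>C\<close> at most
  linear, the points \<open>s = 1\<close> and \<open>s = -1\<close> force \<open>C = s\<close>, and
  the growth at infinity is then contradictory.\<close>

lemma no_rational_Riccati_solution:
  fixes A B :: "complex poly"
  assumes lowest: "\<And>X. B dvd A * X \<Longrightarrow> B dvd X" and B: "B \<noteq> 0"
    and eq: "[:-6,0,6:] * (pderiv A * B - A * pderiv B) = [:0,2:] * A * B - B ^ 2 - A ^ 2"
  shows False
proof -
  let ?b = "degree B"
  \<comment> \<open>Otherwise \<open>A^2\<close> would be the only term of degree
    \<open>2 * degree A\<close>.\<close>
  have deg1: "degree A \<le> ?b + 1"
  proof (rule ccontr)
    assume less: "\<not> degree A \<le> ?b + 1"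
    have dA: "degree (pderiv A) \<le> degree A" "degree (pderiv B) \<le> degree B"
        by (simp_all add: degree_pderiv)
    have "A ^ 2 = [:0,2:] * A * B - B ^ 2 - [:-6,0,6:] * (pderiv A * B - A * pderiv B)"
      using eq by simp
    moreover have "degree ([:0,2:] * A * B) < 2 * degree A"
      using degree_mult_le[of "[:0,2:] * A" B] degree_mult_le[of "[:0,2:]" A] less by simp
    moreover have "degree (B ^ 2) < 2 * degree A"
      using degree_power_le[of B 2] less by simp
    moreover have "degree ([:-6,0,6:] * (pderiv A * B - A * pderiv B)) < 2 * degree A"
    proof -
      have 1: "degree (pderiv A * B) \<le> degree A + ?b - 1"
        using degree_mult_le[of "pderiv A" B] less by (simp add: degree_pderiv)
      have 2: "degree (A * pderiv B) \<le> degree A + ?b - 1"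
      proof (cases "?b = 0")
        case True
        then have "pderiv B = 0" by (simp add: pderiv_eq_0_iff)
        then show ?thesis by simp
      next
        case False
        then show ?thesis using degree_mult_le[of A "pderiv B"] by (simp add: degree_pderiv)
      qed
      have "degree (pderiv A * B - A * pderiv B) \<le> degree A + ?b - 1"
        using 1 2 by (rule degree_diff_le)
      then show ?thesis
        using degree_mult_le[of "[:-6,0,6:]" "pderiv A * B - A * pderiv B"] less by simp
    qed
    ultimately have "degree (A ^ 2) < 2 * degree A"
      by (metis degree_diff_less)
    moreover have "A \<noteq> 0" using less by auto
    ultimately show False by (simp add: degree_power_eq)
  qed
  have "A * (A - [:-6,0,6:] * pderiv B) = B * ([:0,2:] * A - B - [:-6,0,6:] * pderiv A)"
    using eq by algebra
  then have "B dvd A * (A - [:-6,0,6:] * pderiv B)" by simp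
  then have "B dvd A - [:-6,0,6:] * pderiv B"
    by (rule lowest)
  then obtain C where C: "A - [:-6,0,6:] * pderiv B = B * C" by (elim dvdE)
  have degC: "degree C \<le> 1"
  proof (cases "C = 0")
    case False
    have "degree ([:-6,0,6:] * pderiv B) \<le> ?b + 1"
    proof (cases "?b = 0")
      case True
      then have "pderiv B = 0" by (simp add: pderiv_eq_0_iff)
      then show ?thesis by simp
    next
      case False
      then show ?thesis using degree_mult_le[of "[:-6,0,6:]" "pderiv B"]
          by (simp add: degree_pderiv)
    qed
    then have "degree (B * C) \<le> ?b + 1"
      unfolding C[symmetric] using deg1 by (intro degree_diff_le)
    then show ?thesis using B False by (simp add: degree_mult_eq)
  qed simp
  then obtain c0 c1 where C': "C = [:c0, c1:]"
    by (metis degree_eq_zeroE le_SucE One_nat_def degree1_coeffs le_zero_eq pCons_0_0)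
  \<comment> \<open>A common root could be cancelled, making \<open>B\<close> divide a nonzero
    polynomial of smaller degree.\<close>
  have nz: "poly B x \<noteq> 0 \<or> poly A x \<noteq> 0" for x
  proof (rule ccontr)
    assume "\<not> ?thesis"
    then obtain A' B' where AB: "A = [:- x, 1:] * A'" "B = [:- x, 1:] * B'"
      by (auto simp: poly_eq_0_iff_dvd elim!: dvdE)
    have "A * B' = B * A'" unfolding AB by (simp only: mult_ac)
    then have "B dvd A * B'" by (simp only: dvd_triv_left)
    then have "B dvd B'" by (rule lowest)
    moreover have "B' \<noteq> 0" using B AB by auto
    ultimately have "degree B \<le> degree B'" by (rule dvd_imp_degree_le)
    moreover have "degree B = Suc (degree B')"
      using \<open>B' \<noteq> 0\<close> unfolding AB by (subst degree_mult_eq) auto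
    ultimately show False by simp
  qed
  \<comment> \<open>At \<open>s = 1\<close> and \<open>s = -1\<close> the derivative term vanishes
    and the quadratic right-hand side is minus a perfect square.\<close>
  have "(poly A 1 - poly B 1) ^ 2 = 0"
    using arg_cong[OF eq, of "\<lambda>p. poly p 1"] by (simp add: power2_eq_square algebra_simps)
  then have A1: "poly A 1 = poly B 1" by simp
  have "(poly A (-1) + poly B (-1)) ^ 2 = 0"
    using arg_cong[OF eq, of "\<lambda>p. poly p (-1)"] by (simp add: power2_eq_square) algebra
  then have A2: "poly A (-1) = - poly B (-1)" by (simp add: add_eq_0_iff2)
  have "poly A 1 = poly B 1 * (c0 + c1)" "poly A (-1) = poly B (-1) * (c0 - c1)"
    using arg_cong[OF C, of "\<lambda>p. poly p 1"] arg_cong[OF C, of "\<lambda>p. poly p (-1)"]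
        by (simp_all add: C' algebra_simps)
  then have "poly B 1 * (c0 + c1 - 1) = 0" "poly B (-1) * (c0 - c1 + 1) = 0"
    using A1 A2 by algebra+
  then have "c0 + c1 - 1 = 0" "c0 - c1 + 1 = 0"
    using A1 A2 nz[of 1] nz[of "-1"] by auto
  then have "2 * c0 = 0" "2 * c1 = 2" by algebra+
  then have "c0 = 0" "c1 = 1" by simp_all
  then have A: "A = [:-6,0,6:] * pderiv B + [:0,1:] * B"
    using C by (simp add: C' algebra_simps)
  have top: "coeff ([:x,0,6:] * q) (n + 2) = x * coeff q (n + 2) + 6 * coeff q n" for x :: complex
      and q n
    by (simp add: coeff_pCons)
  define l where "l = lead_coeff B"
  have l: "l \<noteq> 0" using B by (simp add: l_def)
  have cA: "coeff A (?b + 1) = (6 * of_nat ?b + 1) * l"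
  proof (cases "?b")
    case 0
    then have "pderiv B = 0" by (simp add: pderiv_eq_0_iff)
    then show ?thesis using 0 by (simp add: A l_def)
  next
    case (Suc k)
    have "coeff ([:-6,0,6:] * pderiv B) (k + 2) = 6 * of_nat (Suc k) * l"
      unfolding top by (simp add: coeff_pderiv l_def Suc coeff_eq_0)
    then show ?thesis by (simp add: A Suc l_def algebra_simps)
  qed
  have fb: "6 * of_nat ?b + 1 \<noteq> (0 :: complex)"
    using of_nat_neq_0[of "6 * ?b", where 'a = complex] by (simp add: add.commute)
  then have "coeff A (?b + 1) \<noteq> 0" using cA l by simp
  then have dA: "degree A = ?b + 1" using deg1 le_degree by (metis le_antisym)
  have lA: "lead_coeff A = (6 * of_nat ?b + 1) * l" using dA cA by simp
  define W where "W = pderiv A * B - A * pderiv B"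
  have W1: "coeff (pderiv A * B) (2 * ?b) = of_nat (?b + 1) * lead_coeff A * l"
    using coeff_mult_degree_sum[of "pderiv A" B]
        by (simp add: degree_pderiv dA coeff_pderiv l_def mult_2)
  have W2: "coeff (A * pderiv B) (2 * ?b) = of_nat ?b * lead_coeff A * l"
  proof (cases "?b")
    case 0
    then have "pderiv B = 0" by (simp add: pderiv_eq_0_iff)
    then show ?thesis using 0 by simp
  next
    case (Suc k)
    then show ?thesis
      using coeff_mult_degree_sum[of A "pderiv B"]
      by (simp add: degree_pderiv dA coeff_pderiv l_def mult_2)
  qed
  have Wd: "coeff W (2 * ?b + 2) = 0"
  proof -
    have "degree (pderiv A * B) \<le> 2 * ?b + 1" "degree (A * pderiv B) \<le> 2 * ?b + 1"
      using degree_mult_le[of "pderiv A" B] degree_mult_le[of A "pderiv B"]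
          by (simp_all add: degree_pderiv dA)
    then show ?thesis by (simp add: W_def coeff_eq_0)
  qed
  \<comment> \<open>If \<open>A/B\<close> grows like \<open>\<rho> s\<close>, the top coefficients
    demand \<open>6 \<rho> = 2 \<rho> - \<rho>^2\<close>, hence \<open>\<rho> = -4\<close>; but
    \<open>\<rho> = 6 * ?b + 1\<close> is positive.\<close>
  have "coeff ([:-6,0,6:] * W) (2 * ?b + 2) = 6 * lead_coeff A * l"
    unfolding top Wd unfolding W_def coeff_diff W1 W2 by (simp add: algebra_simps)
  moreover have "coeff ([:0,2:] * A * B) (2 * ?b + 2) = 2 * lead_coeff A * l"
  proof -
    have "coeff ([:0,2:] * (A * B)) (Suc (2 * ?b + 1)) = 2 * coeff (A * B) (2 * ?b + 1)" by simp
    also have "coeff (A * B) (2 * ?b + 1) = lead_coeff A * l"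
      using coeff_mult_degree_sum[of A B] by (simp add: dA l_def mult_2)
    finally show ?thesis by (simp add: mult.assoc)
  qed
  moreover have "coeff (B ^ 2) (2 * ?b + 2) = 0"
    using degree_power_le[of B 2] by (intro coeff_eq_0) simp
  moreover have "coeff (A ^ 2) (2 * ?b + 2) = lead_coeff A ^ 2"
    using coeff_mult_degree_sum[of A A] by (simp add: dA power2_eq_square mult_2)
  ultimately have "6 * lead_coeff A * l = 2 * lead_coeff A * l - lead_coeff A ^ 2"
    using arg_cong[OF eq, of "\<lambda>p. coeff p (2 * ?b + 2)"] unfolding W_def
        by (simp only: coeff_diff diff_zero)
  then have "lead_coeff A * (4 * l + lead_coeff A) = 0"
    by (simp add: algebra_simps power2_eq_square)
  moreover have "lead_coeff A \<noteq> 0" using lA l fb by simp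
  ultimately have "4 * l + lead_coeff A = 0" by simp
  then have "(6 * of_nat ?b + 5) * l = 0" unfolding lA by (simp add: algebra_simps)
  then have "of_nat (6 * ?b + 5) = (0 :: complex)" using l by simp
  then show False using of_nat_eq_0_iff[of "6 * ?b + 5", where 'a = complex] by simp
qed

section \<open>Algebraic independence\<close>

lemma F1_0 [simp]: "F1 $ 0 = 1" and F2_0 [simp]: "F2 $ 0 = 1"
  by (simp_all add: F1_def F2_def)

lemma F1_nz: "F1 \<noteq> 0"
  by (metis F1_0 fps_zero_nth zero_neq_one)

definition F_ratio :: "complex fps" where "F_ratio = F2 * inverse F1"

lemma F_ratio_F1: "F_ratio * F1 = F2"
  by (simp add: F_ratio_def mult.assoc inverse_mult_eq_1)

lemma F_ratio_0 [simp]: "F_ratio $ 0 = 1"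
  by (simp add: F_ratio_def)

text \<open>The factor \<open>12 * sqrtS\<close> clears denominators, so \<open>Dsys\<close>
  preserves the polynomial ring in \<open>sqrtS\<close>, \<open>F_ratio\<close> and
  \<open>F1\<close>.\<close>

definition Dsys :: "complex fps \<Rightarrow> complex fps" where "Dsys f = 12 * sqrtS * D_q f"

lemma Dsys_add: "Dsys (f + g) = Dsys f + Dsys g" and Dsys_diff: "Dsys (f - g) = Dsys f - Dsys g"
  and Dsys_mult: "Dsys (f * g) = Dsys f * g + f * Dsys g" and Dsys_0 [simp]: "Dsys 0 = 0"
  by (simp_all add: Dsys_def D_q_def algebra_simps)

lemma Dsys_sqrtS: "Dsys sqrtS = 6 * (sqrtS ^ 2 - 1)"
  using sqrtS_D unfolding Dsys_def by algebra

lemma Dsys_F1: "Dsys F1 = (F_ratio - sqrtS) * F1"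
  using D_F1 by (simp add: Dsys_def F_ratio_F1 left_diff_distrib)

lemma Dsys_F_ratio: "Dsys F_ratio = 2 * sqrtS * F_ratio - 1 - F_ratio ^ 2"
proof -
  have "Dsys F2 = sqrtS * F2 - F1" using D_F2 by (simp add: Dsys_def)
  moreover have "Dsys F2 = Dsys F_ratio * F1 + F_ratio * Dsys F1"
      by (simp flip: F_ratio_F1 add: Dsys_mult)
  ultimately have "F1 * Dsys F_ratio = F1 * (2 * sqrtS * F_ratio - 1 - F_ratio ^ 2)"
    using Dsys_F1 F_ratio_F1 by algebra
  then show ?thesis using F1_nz by simp
qed

text \<open>For \<open>e = N / M\<close> the hypothesis reads \<open>Dsys e + h e + c = 0\<close>; at \<open>t = 0\<close> the left-hand side
  has no room for a nonzero \<open>c\<close>, because \<open>Dsys\<close> annihilates constant terms and a pole of \<open>e\<close>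
  would survive in \<open>Dsys e\<close>.\<close>
lemma Dsys_quotient_obstruction:
  fixes N M h :: "complex fps"
  assumes "M \<noteq> 0" "h $ 0 = 0" and eq: "Dsys N * M - N * Dsys M + h * N * M + fps_const c * M
      ^ 2 = 0"
  shows "c = 0"
proof -
  have Dsys_shift: "Dsys (fps_X ^ k * f) = fps_X ^ k * (12 * of_nat k * sqrtS * f + Dsys f)" for k f
  proof -
    have "D_q (fps_X ^ k) = of_nat k * fps_X ^ k"
      by (induction k) (simp_all add: D_q_mult algebra_simps, simp add: D_q_def)
    then show ?thesis by (simp add: Dsys_def D_q_mult algebra_simps)
  qed
  have T0: "Dsys f $ 0 = 0" for f by (simp add: Dsys_def D_q_nth)
  define m where "m = subdegree M"
  define M1 where "M1 = fps_shift m M"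
  have M: "M = fps_X ^ m * M1"
    unfolding M1_def m_def by (metis subdegree_decompose mult.commute)
  have M1: "M1 $ 0 \<noteq> 0" using assms(1) by (simp add: M1_def m_def)
  show ?thesis
  proof (cases "N \<noteq> 0 \<and> subdegree N < m")
    case True
    define k where "k = subdegree N"
    define N1 where "N1 = fps_shift k N"
    have N: "N = fps_X ^ k * N1"
      unfolding N1_def k_def by (metis subdegree_decompose mult.commute)
    have N1: "N1 $ 0 \<noteq> 0" using True by (simp add: N1_def k_def)
    obtain i where i: "m = k + Suc i" using True k_def less_imp_Suc_add by fastforce
    have "fps_X ^ (k + m) * ((12 * of_nat k * sqrtS * N1 + Dsys N1) * M1 - N1 * (12 * of_nat m *
        sqrtS * M1 + Dsys M1)
        + h * N1 * M1 + fps_const c * fps_X ^ Suc i * M1 ^ 2) = 0"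
      using eq unfolding M N Dsys_shift
      by (simp add: i power_add power2_eq_square algebra_simps)
    then have "((12 * of_nat k * sqrtS * N1 + Dsys N1) * M1 - N1 * (12 * of_nat m * sqrtS * M1 +
        Dsys M1)
        + h * N1 * M1 + fps_const c * fps_X ^ Suc i * M1 ^ 2) $ 0 = 0"
      by simp
    then have "12 * (of_nat k - of_nat m) * N1 $ 0 * M1 $ 0 = 0"
      by (simp add: T0 assms(2) algebra_simps)
    then have "of_nat k = (of_nat m :: complex)" using M1 N1 by simp
    then have "k = m" by (simp only: of_nat_eq_iff)
    then show ?thesis using i by simp
  next
    case False
    then obtain N1 where N: "N = fps_X ^ m * N1"
    proof (cases "N = 0")
      case True
      then show ?thesis using that[of 0] by simp
    next
      case False2: False
      have "m \<le> subdegree N" using False False2 by simp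
      then have "fps_shift m N * fps_X ^ m = N" by (rule fps_shift_times_fps_X_power)
      then show ?thesis using that[of "fps_shift m N"] by (simp add: mult.commute)
    qed
    have "fps_X ^ (m + m) * ((12 * of_nat m * sqrtS * N1 + Dsys N1) * M1 - N1 * (12 * of_nat m *
        sqrtS * M1 + Dsys M1)
        + h * N1 * M1 + fps_const c * M1 ^ 2) = 0"
      using eq unfolding M N Dsys_shift
      by (simp add: power_add power2_eq_square algebra_simps)
    then have "((12 * of_nat m * sqrtS * N1 + Dsys N1) * M1 - N1 * (12 * of_nat m * sqrtS * M1 +
        Dsys M1)
        + h * N1 * M1 + fps_const c * M1 ^ 2) $ 0 = 0"
      by simp
    then have "c * (M1 $ 0) ^ 2 = 0" by (simp add: T0 assms(2) fps_nth_power_0)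
    then show ?thesis using M1 by simp
  qed
qed

section \<open>Evaluation at s, r, F1 and the lifted derivations\<close>

definition ev_s :: "complex poly \<Rightarrow> complex fps" where "ev_s = hom_eval fps_const sqrtS"
definition ev_sr :: "complex poly poly \<Rightarrow> complex fps" where "ev_sr = hom_eval ev_s
    F_ratio"
definition ev_srx :: "complex poly poly poly \<Rightarrow> complex fps" where "ev_srx = hom_eval
    ev_sr F1"

lemma hom_ev_s: "is_ring_hom ev_s"
  unfolding ev_s_def by (rule is_ring_hom_hom_eval[OF is_ring_hom_fps_const])
lemma hom_ev_sr: "is_ring_hom ev_sr"
  unfolding ev_sr_def by (rule is_ring_hom_hom_eval[OF hom_ev_s])
lemma hom_ev_srx: "is_ring_hom ev_srx"
  unfolding ev_srx_def by (rule is_ring_hom_hom_eval[OF hom_ev_sr])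

lemmas ev_s_simps = is_ring_homD[OF hom_ev_s] hom_eval_pCons[OF is_ring_hom_fps_const, where x =
    sqrtS, folded ev_s_def]
  hom_eval_smult[OF is_ring_hom_fps_const, where x = sqrtS, folded ev_s_def]
lemmas ev_sr_simps = is_ring_homD[OF hom_ev_sr] hom_eval_pCons[OF hom_ev_s, where x = F_ratio,
    folded ev_sr_def]
  hom_eval_smult[OF hom_ev_s, where x = F_ratio, folded ev_sr_def]
lemmas ev_srx_simps = is_ring_homD[OF hom_ev_srx] hom_eval_pCons[OF hom_ev_sr, where x = F1, folded
    ev_srx_def]
  hom_eval_smult[OF hom_ev_sr, where x = F1, folded ev_srx_def]

definition Riccati_poly :: "complex poly poly" where
  "Riccati_poly = [:[:-1:], [:0,2:], [:-1:]:]"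

text \<open>Writing \<open>s, u, x\<close> for the variables from the innermost to the outermost, these are lifts of \<open>Dsys\<close>:
  \<open>s \<mapsto> 6 (s\<^sup>2 - 1)\<close>, \<open>u \<mapsto> 2 s u - 1 - u\<^sup>2\<close>, \<open>x \<mapsto> (u - s) x\<close>.\<close>
definition Dsys_s :: "complex poly \<Rightarrow> complex poly" where
  "Dsys_s = poly_derivation (\<lambda>_. 0) [:-6,0,6:]"
definition Dsys_sr :: "complex poly poly \<Rightarrow> complex poly poly" where
  "Dsys_sr = poly_derivation Dsys_s Riccati_poly"
definition Dsys_srx :: "complex poly poly poly \<Rightarrow> complex poly poly poly" where
  "Dsys_srx = poly_derivation Dsys_sr [:0, [:[:0,-1:], 1:]:]"

lemma Dsys_s_eq: "Dsys_s p = [:-6,0,6:] * pderiv p"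
proof -
  have "map_poly (\<lambda>_. 0) p = 0" by (rule poly_eqI) (simp add: coeff_map_poly)
  then show ?thesis by (simp add: Dsys_s_def poly_derivation_def mult.commute)
qed

lemma Dsys_s_add: "Dsys_s (p + q) = Dsys_s p + Dsys_s q" and Dsys_s_0: "Dsys_s 0 = 0"
  by (simp_all add: Dsys_s_eq pderiv_add algebra_simps smult_add_right)

lemma Dsys_sr_0: "Dsys_sr 0 = 0"
  by (simp add: Dsys_sr_def poly_derivation_0)

lemma ev_s_Dsys: "ev_s (Dsys_s p) = Dsys (ev_s p)"
  unfolding Dsys_s_def ev_s_def
  by (rule hom_eval_poly_derivation)
     (simp_all add: is_ring_hom_fps_const Dsys_add Dsys_mult Dsys_sqrtS hom_eval_pCons algebra_simps
         power2_eq_square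
       numeral_fps_const fps_const_mult, simp add: Dsys_def D_q_def)

lemma ev_sr_Dsys: "ev_sr (Dsys_sr p) = Dsys (ev_sr p)"
  unfolding Dsys_sr_def ev_sr_def
  by (rule hom_eval_poly_derivation)
     (simp_all add: hom_ev_s Dsys_s_0 Dsys_add Dsys_mult ev_s_Dsys Dsys_F_ratio Riccati_poly_def
         hom_eval_pCons ev_s_simps
       algebra_simps power2_eq_square numeral_fps_const flip: fps_const_neg)

lemma ev_srx_Dsys: "ev_srx (Dsys_srx p) = Dsys (ev_srx p)"
  unfolding Dsys_srx_def ev_srx_def
  by (rule hom_eval_poly_derivation)
     (simp_all add: hom_ev_sr Dsys_sr_0 Dsys_add Dsys_mult ev_sr_Dsys Dsys_F1 hom_eval_pCons
         ev_s_simps ev_sr_simps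
       algebra_simps power2_eq_square numeral_fps_const flip: fps_const_neg)

text \<open>Applying \<open>Dsys\<close> to a relation and cancelling \<open>Dsys sqrtS\<close>
  gives a relation of smaller degree, with polynomial \<open>pderiv p\<close>.\<close>

lemma ev_s_eq_0_iff: "ev_s p = 0 \<longleftrightarrow> p = 0"
proof
  show "ev_s p = 0 \<Longrightarrow> p = 0"
  proof (induction "degree p" arbitrary: p rule: less_induct)
    case less
    show ?case
    proof (cases "degree p = 0")
      case True
      then obtain c where "p = [:c:]" by (rule degree_eq_zeroE)
      then show ?thesis using less.prems by (simp add: ev_s_simps)
    next
      case False
      have "ev_s (Dsys_s p) = 0" using less.prems by (simp add: ev_s_Dsys)
      moreover have "ev_s (Dsys_s p) = Dsys sqrtS * ev_s (pderiv p)"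
        unfolding Dsys_s_eq is_ring_homD(3)[OF hom_ev_s] Dsys_sqrtS
        by (simp add: ev_s_simps algebra_simps power2_eq_square numeral_fps_const flip:
            fps_const_neg)
      moreover have "Dsys sqrtS \<noteq> 0"
        unfolding Dsys_sqrtS sqrtS_square by simp
      ultimately have "ev_s (pderiv p) = 0" by simp
      then have "pderiv p = 0" using less.hyps[of "pderiv p"] False by (simp add: degree_pderiv)
      then show ?thesis using False by (simp add: pderiv_eq_0_iff)
    qed
  qed
qed (simp add: ev_s_simps)

text \<open>A denominator of least degree yields a reduced fraction. As \<open>s\<close> is
  transcendental, the Riccati equation for \<open>F_ratio\<close> becomes a polynomial identity, to
  which \<open>no_rational_Riccati_solution\<close> applies.\<close>

lemma F_ratio_not_rational:
  assumes "ev_s B0 * F_ratio = ev_s A0" "B0 \<noteq> 0"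
  shows False
proof -
  define denom where "denom B \<longleftrightarrow> B \<noteq> 0 \<and> (\<exists>A. ev_s B *
      F_ratio = ev_s A)" for B
  have "denom B0" using assms by (auto simp: denom_def)
  then obtain B1 where B1: "denom B1" and min: "\<And>X. denom X \<Longrightarrow> degree B1 \<le>
      degree X"
    by (metis ex_has_least_nat)
  then obtain A1 where eq: "ev_s B1 * F_ratio = ev_s A1" and B1_nz: "B1 \<noteq> 0"
    by (auto simp: denom_def)
  \<comment> \<open>If \<open>B1\<close> divides \<open>A1 * X\<close>, then \<open>X\<close> is a
    denominator too, and so is its remainder modulo \<open>B1\<close>; minimality makes the
    remainder zero.\<close>
  have lowest: "B1 dvd X" if dvd: "B1 dvd A1 * X" for X
  proof (rule ccontr)
    assume "\<not> B1 dvd X"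
    then have m: "X mod B1 \<noteq> 0" by (simp add: dvd_eq_mod_eq_0)
    obtain Y where "A1 * X = B1 * Y" using dvd by (elim dvdE)
    then have "ev_s B1 * (ev_s X * F_ratio) = ev_s B1 * ev_s Y"
      using eq by (metis is_ring_homD(3)[OF hom_ev_s] mult.assoc mult.commute)
    then have X: "ev_s X * F_ratio = ev_s Y" using B1_nz by (simp add: ev_s_eq_0_iff)
    have "X mod B1 = X - B1 * (X div B1)" by (simp add: minus_mult_div_eq_mod)
    then have "ev_s (X mod B1) * F_ratio = ev_s X * F_ratio - (ev_s B1 * F_ratio) * ev_s (X div B1)"
      by (simp only: is_ring_homD[OF hom_ev_s]) (simp add: algebra_simps)
    also have "\<dots> = ev_s (Y - A1 * (X div B1))"
      unfolding X eq by (simp only: is_ring_homD[OF hom_ev_s])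
    finally have "denom (X mod B1)" using m by (auto simp: denom_def)
    then show False using min degree_mod_less'[OF B1_nz m] by (simp add: not_le[symmetric])
  qed
  have s2: "ev_s [:0,2:] = 2 * sqrtS" by (simp add: ev_s_simps numeral_fps_const)
  have TA: "Dsys (ev_s A1) = Dsys (ev_s B1) * F_ratio + ev_s B1 * (2 * sqrtS * F_ratio - 1 - F_ratio
      ^ 2)"
    using arg_cong[OF eq, of Dsys] by (simp add: Dsys_mult Dsys_F_ratio)
  have "ev_s (Dsys_s A1 * B1 - A1 * Dsys_s B1 - ([:0,2:] * A1 * B1 - B1 ^ 2 - A1 ^ 2)) = 0"
    unfolding power2_eq_square is_ring_homD(3,6)[OF hom_ev_s] ev_s_Dsys TA s2
    unfolding eq[symmetric] by algebra
  then have "Dsys_s A1 * B1 - A1 * Dsys_s B1 = [:0,2:] * A1 * B1 - B1 ^ 2 - A1 ^ 2"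
    unfolding ev_s_eq_0_iff by simp
  then have "[:-6,0,6:] * (pderiv A1 * B1 - A1 * pderiv B1) = [:0,2:] * A1 * B1 - B1 ^ 2 - A1 ^ 2"
    unfolding Dsys_s_eq by algebra
  with lowest B1_nz show False by (rule no_rational_Riccati_solution)
qed

section \<open>Transcendence of r over s, and of F1 over s and r\<close>

lemma coeff_mult_Riccati_poly:
  "coeff (q * Riccati_poly) (Suc (Suc k)) = - coeff q (Suc (Suc k)) + [:0,2:] * coeff q (Suc k) -
      coeff q k"
  by (simp add: Riccati_poly_def mult_pCons_right algebra_simps)

lemma ev_sr_Riccati_poly:
  "ev_sr (pderiv Riccati_poly) = 2 * (sqrtS - F_ratio)" "ev_sr (pderiv (pderiv Riccati_poly)) = -2"
proof -
  have "pderiv Riccati_poly = [:[:0,2:], [:-2:]:]"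
    by (simp add: Riccati_poly_def pderiv_pCons)
  moreover have "pderiv [:[:0,2:], [:-2:]:] = ([:[:-2:]:] :: complex poly poly)"
    by (simp add: pderiv_pCons)
  ultimately show "ev_sr (pderiv Riccati_poly) = 2 * (sqrtS - F_ratio)" "ev_sr (pderiv (pderiv
      Riccati_poly)) = -2"
    by (simp_all add: ev_sr_simps ev_s_simps numeral_fps_const algebra_simps flip: fps_const_neg)
qed

lemma pderiv_Dsys_sr: "pderiv (Dsys_sr p) = Dsys_sr (pderiv p) + pderiv p * pderiv Riccati_poly"
  unfolding Dsys_sr_def by (rule pderiv_poly_derivation) (simp_all add: Dsys_s_0 Dsys_s_add)

text \<open>The term \<open>- u^2\<close> of the Riccati polynomial raises the degree by one, with
  new leading coefficient \<open>- (m + 1) * lead_coeff p\<close>; adding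
  \<open>(m + 1) * u * p\<close> cancels it.\<close>

lemma degree_Dsys_sr_correction:
  assumes m: "degree p = Suc m" and "i > Suc m"
  shows "coeff (Dsys_sr p + smult (of_nat (Suc m)) (pCons 0 p)) i = 0"
proof -
  define k where "k = i - 2"
  have i: "i = Suc (Suc k)" "k \<ge> m" using assms(2) by (auto simp: k_def)
  have "coeff (map_poly Dsys_s p) i = 0"
    using assms by (simp add: coeff_map_poly Dsys_s_0 coeff_eq_0)
  then show ?thesis
    using m i unfolding Dsys_sr_def poly_derivation_def coeff_add i(1) coeff_mult_Riccati_poly
    by (cases "k = m") (simp_all add: coeff_pderiv coeff_eq_0 del: of_nat_Suc)
qed

text \<open>By minimality, \<open>Dsys_sr p\<close> is a multiple of \<open>p\<close> up to the
  coefficient \<open>a\<close>. Two derivatives of this identity in \<open>u\<close>, taken at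
  \<open>r\<close>, give for \<open>e = p''(r) / p'(r)\<close> the equation
  \<open>Dsys e + 2 (s - r) e + 2 m = 0\<close>. The obstruction forces \<open>m = 0\<close>, so
  \<open>p\<close> is linear and \<open>r\<close> rational.\<close>

lemma ev_sr_eq_0_iff: "ev_sr p = 0 \<longleftrightarrow> p = 0"
proof
  show "ev_sr p = 0 \<Longrightarrow> p = 0"
  proof (induction "degree p" arbitrary: p rule: less_induct)
    case less
    show ?case
    proof (cases "degree p")
      case 0
      then obtain c where "p = [:c:]" by (rule degree_eq_zeroE)
      then show ?thesis using less.prems by (simp add: ev_sr_simps ev_s_eq_0_iff)
    next
      case (Suc m)
      define q where "q = Dsys_sr p + smult (of_nat (Suc m)) (pCons 0 p)"
      define a where "a = lead_coeff p"
      define b where "b = coeff q (Suc m)"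
      have "p \<noteq> 0" using Suc by auto
      then have a: "a \<noteq> 0" by (simp add: a_def)
      \<comment> \<open>\<open>q\<close> is again a relation of degree at most \<open>Suc m\<close>;
        cancelling its top coefficient against that of \<open>p\<close> leaves a relation of smaller
        degree.\<close>
      have "smult a q - smult b p = 0"
      proof (rule less.hyps)
        show "degree (smult a q - smult b p) < degree p"
        proof (rule degree_lessI)
          show "\<forall>k\<ge>degree p. coeff (smult a q - smult b p) k = 0"
          proof (intro allI impI)
            fix k assume "k \<ge> degree p"
            then consider "k = Suc m" | "k > Suc m" using Suc by linarith
            then show "coeff (smult a q - smult b p) k = 0"
            proof cases
              case 2
              then show ?thesis
                using degree_Dsys_sr_correction[OF Suc 2, folded q_def] Suc
                    by (simp add: coeff_eq_0)
            qed (use Suc in \<open>simp add: a_def b_def mult.commute\<close>)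
          qed
        qed (use Suc in simp)
        show "ev_sr (smult a q - smult b p) = 0"
          using less.prems by (simp add: q_def ev_sr_simps ev_s_simps ev_sr_Dsys)
      qed
      then have id0: "smult a (Dsys_sr p) = smult b p - smult (a * of_nat (Suc m)) (pCons 0 p)"
        by (simp add: q_def smult_add_right algebra_simps)
      have dX: "pderiv (pCons 0 r) = r + pCons 0 (pderiv r)" for r :: "complex poly poly"
        by (simp add: pderiv_pCons)
      have id1: "smult a (Dsys_sr (pderiv p) + pderiv p * pderiv Riccati_poly)
          = smult b (pderiv p) - smult (a * of_nat (Suc m)) (p + pCons 0 (pderiv p))"
        using arg_cong[OF id0, of pderiv] by (simp only: pderiv_smult pderiv_diff pderiv_Dsys_sr dX)
      have id2: "smult a (Dsys_sr (pderiv (pderiv p)) + pderiv (pderiv p) * pderiv Riccati_poly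
            + (pderiv p * pderiv (pderiv Riccati_poly) + pderiv Riccati_poly * pderiv (pderiv p)))
          = smult b (pderiv (pderiv p)) - smult (a * of_nat (Suc m)) (pderiv p + (pderiv p + pCons 0
              (pderiv (pderiv p))))"
        using arg_cong[OF id1, of pderiv]
        by (simp only: pderiv_smult pderiv_diff pderiv_add pderiv_mult pderiv_Dsys_sr dX)
      define c1 where "c1 = ev_sr (pderiv p)"
      define c2 where "c2 = ev_sr (pderiv (pderiv p))"
      define A where "A = ev_s a"
      define M where "M = (of_nat (Suc m) :: complex fps)"
      have A: "A \<noteq> 0" using a by (simp add: A_def ev_s_eq_0_iff)
      have e1: "A * (Dsys c1 + c1 * (2 * (sqrtS - F_ratio))) = ev_s b * c1 - A * M * (F_ratio * c1)"
        using arg_cong[OF id1, of ev_sr] less.prems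
        by (simp add: ev_sr_simps ev_s_simps ev_sr_Dsys ev_sr_Riccati_poly c1_def A_def M_def del:
            of_nat_Suc)
      have e2: "A * (Dsys c2 + c2 * (2 * (sqrtS - F_ratio)) + (c1 * (-2) + 2 * (sqrtS - F_ratio) *
          c2))
         = ev_s b * c2 - A * M * (c1 + (c1 + F_ratio * c2))"
        using arg_cong[OF id2, of ev_sr]
        by (simp only: ev_sr_simps ev_s_simps ev_sr_Dsys ev_sr_Riccati_poly c1_def c2_def A_def
            M_def add_0)
      \<comment> \<open>The combination \<open>c1 * e2 - c2 * e1\<close> eliminates the unknown
        \<open>b\<close>.\<close>
      have "A * (Dsys c2 * c1 - c2 * Dsys c1 + 2 * (sqrtS - F_ratio) * c2 * c1 + 2 * (M - 1) * c1 ^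
          2)
          = c1 * (A * (Dsys c2 + c2 * (2 * (sqrtS - F_ratio)) + (c1 * (-2) + 2 * (sqrtS - F_ratio) *
              c2))
              - (ev_s b * c2 - A * M * (c1 + (c1 + F_ratio * c2))))
            - c2 * (A * (Dsys c1 + c1 * (2 * (sqrtS - F_ratio))) - (ev_s b * c1 - A * M * (F_ratio *
                c1)))"
        by algebra
      then have "A * (Dsys c2 * c1 - c2 * Dsys c1 + 2 * (sqrtS - F_ratio) * c2 * c1 + 2 * (M - 1) *
          c1 ^ 2) = 0"
        unfolding e1 e2 by simp
      then have eqn: "Dsys c2 * c1 - c2 * Dsys c1 + 2 * (sqrtS - F_ratio) * c2 * c1 + fps_const (2 *
          of_nat m) * c1 ^ 2 = 0"
        using A by (simp add: M_def numeral_fps_const fps_of_nat flip: fps_const_mult)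
      have "c1 \<noteq> 0"
      proof
        assume "c1 = 0"
        then have "pderiv p = 0" using less.hyps[of "pderiv p"] Suc
            by (simp add: c1_def degree_pderiv)
        then show False using Suc by (simp add: pderiv_eq_0_iff)
      qed
      then have "2 * of_nat m = (0 :: complex)"
        by (rule Dsys_quotient_obstruction[OF _ _ eqn]) (simp add: numeral_mult_nth)
      then have "degree p = 1" using Suc by simp
      then obtain A0 B where p: "p = [:A0, B:]" "B \<noteq> 0"
        using degree1_coeffs[of p] by (metis One_nat_def degree_pCons_0 n_not_Suc_n pCons_0_0)
      have "ev_s B * F_ratio = ev_s (- A0)"
        using less.prems by (simp add: p ev_sr_simps ev_s_simps eq_neg_iff_add_eq_0 algebra_simps)
      then show ?thesis using F_ratio_not_rational p(2) by blast
    qed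
  qed
qed (simp add: ev_sr_simps)

text \<open>By minimality, the quotient \<open>g\<close> of the leading by the constant coefficient
  satisfies \<open>D g + n (u - s) g = 0\<close>, with \<open>D\<close> the lifted derivation,
  identically in \<open>s\<close> and \<open>u\<close>. Its logarithmic derivative \<open>e\<close>
  in \<open>u\<close>, taken at \<open>r\<close>, then satisfies
  \<open>Dsys e + 2 (s - r) e + n = 0\<close>, and the obstruction gives
  \<open>n = 0\<close>.\<close>

lemma ev_srx_eq_0_iff: "ev_srx p = 0 \<longleftrightarrow> p = 0"
proof
  show "ev_srx p = 0 \<Longrightarrow> p = 0"
  proof (induction "degree p" arbitrary: p rule: less_induct)
    case less
    obtain p0 p' where p: "p = pCons p0 p'" by (cases p)
    show ?case
    proof (cases "p' = 0")
      case True
      then show ?thesis using less.prems by (simp add: p ev_srx_simps ev_sr_eq_0_iff)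
    next
      case False
      define n where "n = degree p"
      have n: "n = Suc (degree p')" using False by (simp add: n_def p)
      have X: "r = 0" if "ev_srx (pCons 0 r) = 0" "degree r < n \<or> r = 0" for r
        using that less.hyps[of r] F1_nz by (auto simp: ev_srx_simps ev_sr_simps n_def)
      have p0: "p0 \<noteq> 0"
        using less.prems False X[of p'] n p by auto
      define e :: "complex poly poly" where "e = [:[:0,-1:], 1:]"
      \<comment> \<open>A further relation of degree at most \<open>n\<close>, built so that its
        constant coefficient vanishes; after cancelling \<open>F1\<close> it falls under the
        induction hypothesis.\<close>
      define q where "q = smult p0 (Dsys_srx p) - smult (Dsys_sr p0) p"
      have Dsys_srx: "Dsys_srx p = map_poly Dsys_sr p + pCons 0 (smult e (pderiv p))"
        by (simp add: Dsys_srx_def poly_derivation_def e_def[symmetric] mult.commute)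
      have "coeff p 0 = p0" by (simp add: p)
      then have q0: "coeff q 0 = 0"
        by (simp add: q_def Dsys_srx coeff_map_poly Dsys_sr_0)
      obtain r where r: "q = pCons 0 r" using q0 by (cases q) auto
      have qi: "coeff q i = 0" if "i > n" for i
      proof -
        have "coeff p i = 0" using that by (simp add: n_def coeff_eq_0)
        then show ?thesis using that
          by (cases i) (simp_all add: q_def Dsys_srx coeff_map_poly Dsys_sr_0 coeff_pderiv del:
              of_nat_Suc)
      qed
      have "coeff r i = 0" if "i \<ge> n" for i using qi[of "Suc i"] that by (simp add: r)
      then have "degree r < n" using n by (intro degree_lessI) auto
      moreover have "ev_srx (pCons 0 r) = 0"
        using less.prems by (simp add: r[symmetric] q_def ev_srx_simps ev_srx_Dsys)
      ultimately have "q = 0" using X r by simp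
      define pn where "pn = lead_coeff p"
      have pn: "pn \<noteq> 0" using False by (simp add: pn_def p)
      have "coeff q n = 0" using \<open>q = 0\<close> by simp
      then have id0: "p0 * (Dsys_sr pn + e * (of_nat n * pn)) - Dsys_sr p0 * pn = 0"
        using n by (simp add: q_def Dsys_srx coeff_map_poly Dsys_sr_0 coeff_pderiv pn_def n_def del:
            of_nat_Suc)
      define f0 where "f0 = ev_sr p0" define f1 where "f1 = ev_sr (pderiv p0)"
      define g0 where "g0 = ev_sr pn" define g1 where "g1 = ev_sr (pderiv pn)"
      define N where "N = (of_nat n :: complex fps)"
      have ee: "ev_sr e = F_ratio - sqrtS" "pderiv e = 1"
        by (simp_all add: e_def ev_sr_simps ev_s_simps pderiv_pCons one_pCons flip: fps_const_neg)
      have e0: "f0 * (Dsys g0 + (F_ratio - sqrtS) * (N * g0)) - Dsys f0 * g0 = 0"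
        using arg_cong[OF id0, of ev_sr]
        by (simp add: ev_sr_simps ev_sr_Dsys ee f0_def g0_def N_def)
      have pn_nat: "pderiv (of_nat n * r) = of_nat n * pderiv r" for r :: "complex poly poly"
        by (simp add: pderiv_mult)
      have e1: "f0 * (Dsys g1 + g1 * (2 * (sqrtS - F_ratio)) + ((F_ratio - sqrtS) * (N * g1) + N *
          g0 * 1)) + (Dsys g0 + (F_ratio - sqrtS) * (N * g0)) * f1
           - (Dsys f0 * g1 + g0 * (Dsys f1 + f1 * (2 * (sqrtS - F_ratio)))) = 0"
        using arg_cong[OF arg_cong[OF id0, of pderiv], of ev_sr]
        unfolding pderiv_diff pderiv_mult[of p0] pderiv_add pderiv_mult[of e] pderiv_mult[of
            "Dsys_sr p0"] pderiv_Dsys_sr ee(2) pn_nat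
        by (simp only: ev_sr_simps(1-7) ev_sr_Dsys ee(1) ev_sr_Riccati_poly f0_def g0_def f1_def
            g1_def N_def pderiv_0)
      \<comment> \<open>\<open>W / (f0 * g0)\<close> is the logarithmic derivative of the
        quotient.\<close>
      define W where "W = g1 * f0 - g0 * f1"
      have TW: "Dsys W = Dsys g1 * f0 + g1 * Dsys f0 - Dsys g0 * f1 - g0 * Dsys f1"
        by (simp add: W_def Dsys_mult Dsys_diff algebra_simps)
      have TM: "Dsys (f0 * g0) = Dsys f0 * g0 + f0 * Dsys g0" by (rule Dsys_mult)
      have "Dsys W * (f0 * g0) - W * Dsys (f0 * g0) + 2 * (sqrtS - F_ratio) * W * (f0 * g0) + N *
          (f0 * g0) ^ 2
          = f0 * g0 * (f0 * (Dsys g1 + g1 * (2 * (sqrtS - F_ratio)) + ((F_ratio - sqrtS) * (N * g1)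
              + N * g0 * 1))
              + (Dsys g0 + (F_ratio - sqrtS) * (N * g0)) * f1 - (Dsys f0 * g1 + g0 * (Dsys f1 + f1 *
                  (2 * (sqrtS - F_ratio)))))
            - (f0 * g1 + g0 * f1) * (f0 * (Dsys g0 + (F_ratio - sqrtS) * (N * g0)) - Dsys f0 * g0)"
        unfolding TW TM unfolding W_def by algebra
      then have eqn: "Dsys W * (f0 * g0) - W * Dsys (f0 * g0) + 2 * (sqrtS - F_ratio) * W * (f0 *
          g0) + fps_const (of_nat n) * (f0 * g0) ^ 2 = 0"
        unfolding e0 e1 by (simp only: N_def fps_of_nat) simp
      have "f0 * g0 \<noteq> 0" using p0 pn by (simp add: f0_def g0_def ev_sr_eq_0_iff)
      then have "of_nat n = (0 :: complex)"
        by (rule Dsys_quotient_obstruction[OF _ _ eqn]) (simp add: numeral_mult_nth)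
      then have "n = 0" by (simp only: of_nat_eq_0_iff)
      then show ?thesis using n by simp
    qed
  qed
qed (simp add: ev_srx_simps)

section \<open>The ring generated by the hypergeometric series\<close>

lemma hom_sum:
  assumes "is_ring_hom h"
  shows "h (sum f A) = (\<Sum>x\<in>A. h (f x))"
  by (induction A rule: infinite_finite_induct) (simp_all add: is_ring_homD[OF assms])

lemma hom_eval_monom:
  assumes "is_ring_hom h"
  shows "hom_eval h x (monom a n) = h a * x ^ n"
  by (simp add: hom_eval_def map_poly_monom is_ring_homD[OF assms] poly_monom)

lemma hom_eval_altdef:
  assumes "is_ring_hom h"
  shows "hom_eval h x p = (\<Sum>i\<le>degree p. h (coeff p i) * x ^ i)"
proof -
  have "hom_eval h x (\<Sum>i\<le>degree p. monom (coeff p i) i) = (\<Sum>i\<le>degree p. h (coeff p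
      i) * x ^ i)"
    by (simp add: hom_sum[OF is_ring_hom_hom_eval[OF assms]] hom_eval_monom[OF assms])
  then show ?thesis by (simp add: poly_as_sum_of_monoms)
qed

lemma hom_hom_eval:
  assumes "is_ring_hom h" "is_ring_hom k"
  shows "k (hom_eval h x p) = hom_eval (\<lambda>a. k (h a)) (k x) p"
proof -
  have kh: "is_ring_hom (\<lambda>a. k (h a))"
    using assms by (simp add: is_ring_hom_def)
  show ?thesis
    by (induction p)
       (simp_all add: hom_eval_pCons[OF assms(1)] hom_eval_pCons[OF kh] is_ring_homD[OF assms(2)])
qed

lemma eval3_eq: "eval3 P a b c = hom_eval (hom_eval (hom_eval fps_const a) b) c P"
  by (simp add: eval3_def hom_eval_def[abs_def])

lemma eval3_sum:
  "eval3 P a b c = (\<Sum>k\<le>degree P. \<Sum>j\<le>degree (coeff P k). \<Sum>i\<le>degree (coeff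
      (coeff P k) j).
      fps_const (coeff (coeff (coeff P k) j) i) * a ^ i * b ^ j * c ^ k)"
  unfolding eval3_eq
  by (simp add: hom_eval_altdef is_ring_hom_hom_eval is_ring_hom_fps_const sum_distrib_right)

lemma is_ring_hom_eval3: "is_ring_hom (\<lambda>P. eval3 P a b c)"
  unfolding eval3_eq by (intro is_ring_hom_hom_eval is_ring_hom_fps_const)

text \<open>Since \<open>G2 = F_ratio * F1^2\<close>, the monomial \<open>G2^i * G4^j * G6^k\<close>
  is \<open>s^k * r^i * F1^(2i+4j+6k)\<close>. These exponents determine \<open>i\<close>,
  \<open>j\<close> and \<open>k\<close>, so no cancellation occurs.\<close>

lemma eval3_G_eq_0:
  assumes "eval3 P G2 G4 G6 = 0"
  shows "P = 0"
proof (rule ccontr)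
  assume "P \<noteq> 0"
  define p where "p k j i = coeff (coeff (coeff P k) j) i" for i j k
  define M where "M k j i = monom (monom (monom (p k j i) k) i) (2 * i + 4 * j + 6 * k)" for i j k
  define R where "R = (\<Sum>k\<le>degree P. \<Sum>j\<le>degree (coeff P k). \<Sum>i\<le>degree
      (coeff (coeff P k) j). M k j i)"
  have G2: "G2 = F_ratio * F1 ^ 2" by (simp add: G2_def flip: F_ratio_F1) (simp add:
      power2_eq_square algebra_simps)
  have "ev_srx (M k j i) = fps_const (p k j i) * G2 ^ i * G4 ^ j * G6 ^ k" for i j k
  proof -
    have "ev_srx (M k j i) = fps_const (p k j i) * sqrtS ^ k * F_ratio ^ i * F1 ^ (2 * i + 4 * j + 6
        * k)"
      unfolding M_def ev_srx_def hom_eval_monom[OF hom_ev_sr]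
      unfolding ev_sr_def hom_eval_monom[OF hom_ev_s]
      unfolding ev_s_def hom_eval_monom[OF is_ring_hom_fps_const] ..
    also have "\<dots> = fps_const (p k j i) * G2 ^ i * G4 ^ j * G6 ^ k"
      by (simp add: G2 G4_def G6_def power_mult_distrib power_add mult_ac flip: power_mult)
    finally show ?thesis .
  qed
  then have "ev_srx R = eval3 P G2 G4 G6"
    by (simp add: R_def hom_sum[OF hom_ev_srx] eval3_sum p_def)
  then have R: "R = 0" using assms ev_srx_eq_0_iff by simp
  \<comment> \<open>Successive leading coefficients pick out one nonzero coefficient of
    \<open>P\<close>.\<close>
  define k0 where "k0 = degree P"
  define j0 where "j0 = degree (coeff P k0)"
  define i0 where "i0 = degree (coeff (coeff P k0) j0)"
  have "coeff P k0 \<noteq> 0" using \<open>P \<noteq> 0\<close> by (simp add: k0_def)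
  then have "coeff (coeff P k0) j0 \<noteq> 0" by (simp add: j0_def)
  then have nz: "p k0 j0 i0 \<noteq> 0" by (simp add: i0_def p_def)
  have M: "coeff (coeff (coeff (M k j i) (2 * i0 + 4 * j0 + 6 * k0)) i0) k0
      = (if k = k0 then if j = j0 then if i = i0 then p k0 j0 i0 else 0 else 0 else 0)" for i j k
    by (auto simp: M_def)
  have pull: "(\<Sum>x\<in>A. if b then f x else 0) = (if b then \<Sum>x\<in>A. f x else 0)"
    for b and A :: "nat set" and f :: "nat \<Rightarrow> complex" by simp
  have "coeff (coeff (coeff R (2 * i0 + 4 * j0 + 6 * k0)) i0) k0
     = (\<Sum>k\<le>degree P. if k = k0 then (\<Sum>j\<le>degree (coeff P k0). if j = j0
           then (\<Sum>i\<le>degree (coeff (coeff P k0) j0). if i = i0 then p k0 j0 i0 else 0) else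
               0) else 0)"
    unfolding R_def coeff_sum M pull by (intro sum.cong if_cong refl) simp_all
  also have "\<dots> = p k0 j0 i0"
    by (simp add: k0_def[symmetric] j0_def[symmetric] i0_def[symmetric])
  finally show False using R nz by simp
qed

lemma eval3_G_compose: "eval3 P G2 G4 G6 oo tq = eval3 P E2q E4q E6q"
proof -
  have comp: "is_ring_hom (\<lambda>f :: complex fps. f oo tq)"
    by (simp add: is_ring_hom_def fps_compose_add_distrib fps_compose_mult_distrib)
  have "G2 oo tq = E2q" "G4 oo tq = E4q" "G6 oo tq = E6q"
    using F1_tq F2_tq sqrtS_tq
    by (simp_all add: G2_def G4_def G6_def fps_compose_mult_distrib fps_compose_power)
  then show ?thesis
    unfolding eval3_eq
    by (simp add: hom_hom_eval[OF _ comp] is_ring_hom_hom_eval is_ring_hom_fps_const)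
qed

section \<open>Closure under the derivation\<close>

lemma D_F_add: "D_F (f + g) = D_F f + D_F g"
  and D_F_mult: "D_F (f * g) = D_F f * g + f * D_F g"
  by (simp_all add: D_F_def algebra_simps)

lemma D_F_Dsys: "12 * D_F f = F1 ^ 2 * Dsys f"
  by (simp add: D_F_def Dsys_def D_q_def algebra_simps)

text \<open>Ramanujan's equations on the hypergeometric side, read off directly from the linear
  system.\<close>

lemma D_F_generators:
  "12 * D_F G2 = G2 ^ 2 - G4" "3 * D_F G4 = G2 * G4 - G6" "2 * D_F G6 = G2 * G6 - G4 ^ 2"
proof -
  have Dsys: "Dsys F1 = F2 - sqrtS * F1" "Dsys F2 = sqrtS * F2 - F1"
    using D_F1 D_F2 by (simp_all add: Dsys_def)
  have T4: "Dsys (F1 ^ 4) = 4 * F1 ^ 3 * Dsys F1" "Dsys (F1 ^ 6) = 6 * F1 ^ 5 * Dsys F1"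
    by (simp_all add: eval_nat_numeral Dsys_mult algebra_simps)
  show "12 * D_F G2 = G2 ^ 2 - G4"
    unfolding D_F_Dsys G2_def G4_def Dsys_mult Dsys by algebra
  have "4 * (3 * D_F G4) = 12 * D_F G4" by simp
  also have "\<dots> = 4 * (G2 * G4 - G6)"
    unfolding D_F_Dsys unfolding G2_def G4_def G6_def T4 Dsys by algebra
  finally show "3 * D_F G4 = G2 * G4 - G6" by (metis mult_cancel_left zero_neq_numeral)
  have "6 * (2 * D_F G6) = 12 * D_F G6" by simp
  also have "\<dots> = 6 * (G2 * G6 - G4 ^ 2)"
    unfolding D_F_Dsys unfolding G2_def G4_def G6_def Dsys_mult T4 Dsys Dsys_sqrtS by algebra
  finally show "2 * D_F G6 = G2 * G6 - G4 ^ 2" by (metis mult_cancel_left zero_neq_numeral)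
qed

text \<open>The product rule for \<open>D\<close> needs the undifferentiated factors as well, so
  membership of the value and of its derivative are proved together.\<close>

lemma hom_eval_derivation_closed:
  assumes h: "is_ring_hom h" and D: "\<And>f g. D (f + g) = D f + D g" "\<And>f g. D (f * g) = D f *
      g + f * D g"
    and S: "\<And>f g. f \<in> S \<Longrightarrow> g \<in> S \<Longrightarrow> f + g \<in> S"
        "\<And>f g. f \<in> S \<Longrightarrow> g \<in> S \<Longrightarrow> f * g \<in> S"
    and hS: "\<And>a. h a \<in> S \<and> D (h a) \<in> S" and x: "x \<in> S \<and> D x \<in> S"
  shows "hom_eval h x p \<in> S \<and> D (hom_eval h x p) \<in> S"
proof (induction p)
  case 0
  show ?case using hS[of 0] by (simp add: is_ring_homD[OF h])
next
  case (pCons a p)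
  then show ?case using hS[of a] x by (simp add: hom_eval_pCons[OF h] D S)
qed

lemma D_F_closed: "\<exists>Q. D_F (eval3 P G2 G4 G6) = eval3 Q G2 G4 G6"
proof -
  define S where "S = range (\<lambda>Q. eval3 Q G2 G4 G6)"
  note H = is_ring_homD[OF is_ring_hom_eval3[of G2 G4 G6]]
  have S: "f + g \<in> S" "f * g \<in> S" "f - g \<in> S" if "f \<in> S" "g \<in> S" for f g
    using that by (auto simp: S_def H(2,3,6)[symmetric])
  have ev: "eval3 [:[:[:c:]:]:] a b d = fps_const c" "eval3 [:[:[:0,1:]:]:] a b d = a"
    "eval3 [:[:0,1:]:] a b d = b" "eval3 [:0,1:] a b d = d" for a b c d
    by (simp_all add: eval3_eq hom_eval_pCons is_ring_hom_hom_eval is_ring_hom_fps_const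
        is_ring_homD)
  have const: "fps_const c \<in> S" for c unfolding S_def by (metis ev(1) rangeI)
  have G: "G2 \<in> S" "G4 \<in> S" "G6 \<in> S" unfolding S_def by (metis ev(2-4) rangeI)+
  \<comment> \<open>\<open>S\<close> contains the complex constants, so the numerical factors of
    \<open>D_F_generators\<close> can be divided out.\<close>
  have div: "f \<in> S" if "numeral k * f \<in> S" for f k
  proof -
    have "f = fps_const (1 / numeral k) * (numeral k * f)"
      by (simp add: numeral_fps_const flip: mult.assoc)
    also have "\<dots> \<in> S" using that const S(2) by blast
    finally show ?thesis .
  qed
  have "12 * D_F G2 \<in> S" "3 * D_F G4 \<in> S" "2 * D_F G6 \<in> S"
    unfolding D_F_generators power2_eq_square by (intro S G)+
  then have "D_F G2 \<in> S" "D_F G4 \<in> S" "D_F G6 \<in> S" by (auto intro: div)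
  moreover have "D_F (fps_const c) \<in> S" for c using const[of 0] by (simp add: D_F_def)
  ultimately have "eval3 P G2 G4 G6 \<in> S \<and> D_F (eval3 P G2 G4 G6) \<in> S"
    unfolding eval3_eq
    by (intro hom_eval_derivation_closed is_ring_hom_hom_eval is_ring_hom_fps_const)
       (simp_all add: S const G D_F_add D_F_mult)
  then show ?thesis by (auto simp: S_def)
qed

text \<open>The polynomial ring stands for the ring of quasimodular forms, and the ring of
  hypergeometric series is the range of \<open>eval3\<close> at \<open>G2\<close>,
  \<open>G4\<close>, \<open>G6\<close>. Surjectivity is thus built in and the first conjunct is
  injectivity. The last conjunct is an instance of \<open>D_F_compose\<close>, valid for all
  series.\<close>

theorem theorem2p2:
  shows "(\<forall>P. eval3 P G2 G4 G6 = 0 \<longrightarrow> P = 0)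
       \<and> (\<forall>P. eval3 P G2 G4 G6 oo tq = eval3 P E2q E4q E6q)
       \<and> (\<forall>P. \<exists>Q. D_F (eval3 P G2 G4 G6) = eval3 Q G2 G4 G6)
       \<and> (\<forall>P. D_F (eval3 P G2 G4 G6) oo tq = D_q (eval3 P G2 G4 G6 oo tq))"
  using eval3_G_eq_0 eval3_G_compose D_F_closed D_F_compose by blast

end
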